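(* Let $K$ be a number field, let $n \geq 2$, and let $D$ be the divisor on $\mathbb{P}^n_K$ \[ D = H_1 + \dots + H_{n-1} + Q, \] where $H_1,\dots,H_{n-1}\subset\mathbb{P}^n_K$ are hyperplanes defined over $K$ in general position and $Q\subset \mathbb{P}^n_K$ is a smooth quadric hypersurface defined over $K$. Suppose that the line $L := H_1\cap\dots\cap H_{n-1}$ meets $Q$ in two distinct $K$-rational points. Then the integral points on $\mathbb{P}^n_K\setminus D$ are potentially dense.
   Context: Let $K$ be a number field and $S$ a finite set of places of $K$ containing all archimedean places; $\mathcal{O}_S=\{x\in K: v(x)\ge 0 \text{ for all finite } v\notin S\}$. For a finite place $v$, $\mathcal{O}_v$ is the valuation ring, $\mathfrak{m}_v$ its maximal ideal and $k_v$ its residue field. Reduction: for a closed subvariety $Z\subset\mathbb{P}^n_K$ with radical homogeneous ideal $I\subset K[X_0,\dots,X_n]$, $Z_v\subset\mathbb{P}^n_{k_v}$ is the zero set of the image of $I\cap\mathcal{O}_v[X_0,\dots,X_n]$ in $k_v[X_0,\dots,X_n]$. For $x\in\mathbb{P}^n(K)$, $x_v\in\mathbb{P}^n(k_v)$ is its reduction (choose coordinates in $\mathcal{O}_v$ not all in $\mathfrak{m}_v$ and reduce mod $\mathfrak{m}_v$); $x$ reduces to $Z$ at $v$ if $x_v\in Z_v$. For a quasi-projective $X\subset\mathbb{P}^n_K$ with Zariski closure $\widetilde X$ and a proper closed subvariety $D\subset X$ (divisors are identified with their supports), $x\in X(K)$ is an $S$-integral point of $X\setminus D$ if for every finite place $v\notin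 S$, $x$ does not reduce to $D\cup(\widetilde X\setminus X)$ at $v$; the set of these is $(X\setminus D)(\mathcal{O}_S)$. For $X$ projective, the integral points on $X\setminus D$ are potentially dense if there exist a finite extension $K'/K$ and a finite set $S'$ of places of $K'$ containing all places above those of $S$ (and all archimedean places) such that $(X\setminus D)(\mathcal{O}_{S'})$, computed over $K'$, is Zariski dense in $X_{K'}$. *)

theory Defs
  imports Complex_Main "HOL-Library.Poly_Mapping"
begin

definition subfield :: "complex set \<Rightarrow> bool" where
  "subfield F \<longleftrightarrow> 0 \<in> F \<and> 1 \<in> F \<and>
     (\<forall>x\<in>F. \<forall>y\<in>F. x + y \<in> F \<and> x * y \<in> F) \<and>
     (\<forall>x\<in>F. - x \<in> F) \<and> (\<forall>x\<in>F. x \<noteq> 0 \<longrightarrow> inverse x \<in> F)"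

definition number_field :: "complex set \<Rightarrow> bool" where
  "number_field F \<longleftrightarrow> subfield F \<and>
     (\<exists>B. finite B \<and> B \<subseteq> F \<and>
        (\<forall>x\<in>F. \<exists>c :: complex \<Rightarrow> rat. x = (\<Sum>b\<in>B. of_rat (c b) * b)))"

definition abs_val :: "complex set \<Rightarrow> (complex \<Rightarrow> real) \<Rightarrow> bool" where
  "abs_val F \<phi> \<longleftrightarrow>
     (\<forall>x. x \<notin> F \<longrightarrow> \<phi> x = 0) \<and>
     (\<forall>x\<in>F. \<phi> x \<ge> 0 \<and> (\<phi> x = 0 \<longleftrightarrow> x = 0)) \<and>
     (\<forall>x\<in>F. \<forall>y\<in>F. \<phi> (x * y) = \<phi> x * \<phi> y \<and> \<phi> (x + y) \<le> \<phi> x + \<phi> y)"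

definition nontrivial_abs :: "complex set \<Rightarrow> (complex \<Rightarrow> real) \<Rightarrow> bool" where
  "nontrivial_abs F \<phi> \<longleftrightarrow> (\<exists>x\<in>F. x \<noteq> 0 \<and> \<phi> x \<noteq> 1)"

definition nonarch :: "complex set \<Rightarrow> (complex \<Rightarrow> real) \<Rightarrow> bool" where
  "nonarch F \<phi> \<longleftrightarrow> (\<forall>x\<in>F. \<forall>y\<in>F. \<phi> (x + y) \<le> max (\<phi> x) (\<phi> y))"

definition place :: "complex set \<Rightarrow> (complex \<Rightarrow> real) set \<Rightarrow> bool" where
  "place F v \<longleftrightarrow> (\<exists>\<phi>. abs_val F \<phi> \<and> nontrivial_abs F \<phi> \<and>
     v = {\<psi>. abs_val F \<psi> \<and> (\<exists>c>0. \<forall>x\<in>F. \<psi> x = \<phi> x powr c)})"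

definition archimedean_place :: "complex set \<Rightarrow> (complex \<Rightarrow> real) set \<Rightarrow> bool" where
  "archimedean_place F v \<longleftrightarrow> place F v \<and> (\<exists>\<phi>\<in>v. \<not> nonarch F \<phi>)"

definition finite_place :: "complex set \<Rightarrow> (complex \<Rightarrow> real) set \<Rightarrow> bool" where
  "finite_place F v \<longleftrightarrow> place F v \<and> (\<forall>\<phi>\<in>v. nonarch F \<phi>)"

definition lies_over :: "complex set \<Rightarrow> (complex \<Rightarrow> real) set \<Rightarrow> (complex \<Rightarrow> real) set \<Rightarrow> bool" where
  "lies_over F w v \<longleftrightarrow> (\<exists>\<psi>\<in>w. \<exists>\<phi>\<in>v. \<forall>x\<in>F. \<psi> x = \<phi> x)"

definition val_ring :: "complex set \<Rightarrow> (complex \<Rightarrow> real) set \<Rightarrow> complex set" where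
  "val_ring F v = {x\<in>F. \<exists>\<phi>\<in>v. \<phi> x \<le> 1}"

definition val_max_ideal :: "complex set \<Rightarrow> (complex \<Rightarrow> real) set \<Rightarrow> complex set" where
  "val_max_ideal F v = {x\<in>F. \<exists>\<phi>\<in>v. \<phi> x < 1}"

type_synonym mpoly = "(nat \<Rightarrow>\<^sub>0 nat) \<Rightarrow>\<^sub>0 complex"

definition mpeval :: "mpoly \<Rightarrow> (nat \<Rightarrow> complex) \<Rightarrow> complex" where
  "mpeval p x = (\<Sum>m\<in>Poly_Mapping.keys p. Poly_Mapping.lookup p m * (\<Prod>i\<in>Poly_Mapping.keys m. x i ^ Poly_Mapping.lookup m i))"

definition homogeneous_poly :: "nat \<Rightarrow> complex set \<Rightarrow> mpoly \<Rightarrow> bool" where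
  "homogeneous_poly n R p \<longleftrightarrow> (\<forall>m. Poly_Mapping.lookup p m \<in> R) \<and>
     (\<forall>m\<in>Poly_Mapping.keys p. Poly_Mapping.keys m \<subseteq> {..n}) \<and>
     (\<exists>d. \<forall>m\<in>Poly_Mapping.keys p. (\<Sum>i\<in>Poly_Mapping.keys m. Poly_Mapping.lookup m i) = d)"

text \<open>Coordinate vectors (X_0..X_n) of points of P^n(F); a point is represented by
  any of its coordinate vectors (only the coordinates 0..n matter).\<close>
definition proj_point :: "complex set \<Rightarrow> nat \<Rightarrow> (nat \<Rightarrow> complex) \<Rightarrow> bool" where
  "proj_point F n x \<longleftrightarrow> (\<forall>i\<le>n. x i \<in> F) \<and> (\<exists>i\<le>n. x i \<noteq> 0)"

definition proj_eq :: "nat \<Rightarrow> (nat \<Rightarrow> complex) \<Rightarrow> (nat \<Rightarrow> complex) \<Rightarrow> bool" where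
  "proj_eq n x y \<longleftrightarrow> (\<exists>c. c \<noteq> 0 \<and> (\<forall>i\<le>n. y i = c * x i))"

text \<open>Homogeneous ideal over F of a closed subset Z of P^n, Z given by its set of
  geometric (complex) points: the homogeneous polynomials with coefficients in F
  vanishing on Z.\<close>
definition vanishing_ideal :: "complex set \<Rightarrow> nat \<Rightarrow> (nat \<Rightarrow> complex) set \<Rightarrow> mpoly set" where
  "vanishing_ideal F n Z = {f. homogeneous_poly n F f \<and> (\<forall>x\<in>Z. mpeval f x = 0)}"

text \<open>x reduces to Z at the finite place v of F: with coordinates y of x in O_v not all
  in m_v, every f in I \<inter> O_v[X] has f(y) \<in> m_v, i.e. the reduction of f vanishes at x_v.\<close>
definition reduces_to :: "complex set \<Rightarrow> (complex \<Rightarrow> real) set \<Rightarrow> nat \<Rightarrow> (nat \<Rightarrow> complex) set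
    \<Rightarrow> (nat \<Rightarrow> complex) \<Rightarrow> bool" where
  "reduces_to F v n Z x \<longleftrightarrow> (\<exists>y. (\<exists>c\<in>F. c \<noteq> 0 \<and> (\<forall>i\<le>n. y i = c * x i)) \<and>
      (\<forall>i\<le>n. y i \<in> val_ring F v) \<and> (\<exists>i\<le>n. y i \<notin> val_max_ideal F v) \<and>
      (\<forall>f\<in>vanishing_ideal F n Z. homogeneous_poly n (val_ring F v) f \<longrightarrow>
          mpeval f y \<in> val_max_ideal F v))"

text \<open>S-integral points of P^n \ D over F (P^n is projective, so no boundary).\<close>
definition integral_points :: "complex set \<Rightarrow> (complex \<Rightarrow> real) set set \<Rightarrow> nat
    \<Rightarrow> (nat \<Rightarrow> complex) set \<Rightarrow> (nat \<Rightarrow> complex) set" where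
  "integral_points F S n D = {x. proj_point F n x \<and>
      (\<forall>v. finite_place F v \<and> v \<notin> S \<longrightarrow> \<not> reduces_to F v n D x)}"

definition zariski_dense :: "complex set \<Rightarrow> nat \<Rightarrow> (nat \<Rightarrow> complex) set \<Rightarrow> bool" where
  "zariski_dense F n A \<longleftrightarrow> (\<forall>f. homogeneous_poly n F f \<and> (\<forall>x\<in>A. mpeval f x = 0) \<longrightarrow> f = 0)"

definition admissible_places :: "complex set \<Rightarrow> (complex \<Rightarrow> real) set set \<Rightarrow> bool" where
  "admissible_places F S \<longleftrightarrow> finite S \<and> (\<forall>v\<in>S. place F v) \<and>
      (\<forall>v. archimedean_place F v \<longrightarrow> v \<in> S)"

definition potentially_dense_integral :: "complex set \<Rightarrow> (complex \<Rightarrow> real) set set \<Rightarrow> nat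
    \<Rightarrow> (nat \<Rightarrow> complex) set \<Rightarrow> bool" where
  "potentially_dense_integral K S n D \<longleftrightarrow>
     (\<exists>K' S'. number_field K' \<and> K \<subseteq> K' \<and> admissible_places K' S' \<and>
        (\<forall>w. place K' w \<and> (\<exists>v\<in>S. lies_over K w v) \<longrightarrow> w \<in> S') \<and>
        zariski_dense K' n (integral_points K' S' n D))"

definition lin_form :: "nat \<Rightarrow> (nat \<Rightarrow> complex) \<Rightarrow> (nat \<Rightarrow> complex) \<Rightarrow> complex" where
  "lin_form n a x = (\<Sum>j\<le>n. a j * x j)"

definition quad_form :: "nat \<Rightarrow> (nat \<Rightarrow> nat \<Rightarrow> complex) \<Rightarrow> (nat \<Rightarrow> complex) \<Rightarrow> complex" where
  "quad_form n B x = (\<Sum>i\<le>n. \<Sum>j\<le>n. B i j * x i * x j)"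

definition quad_partial :: "nat \<Rightarrow> (nat \<Rightarrow> nat \<Rightarrow> complex) \<Rightarrow> nat \<Rightarrow> (nat \<Rightarrow> complex) \<Rightarrow> complex" where
  "quad_partial n B k x = (\<Sum>j\<le>n. (B k j + B j k) * x j)"

text \<open>Smooth quadric hypersurface (Jacobian criterion at all geometric points).\<close>
definition smooth_quadric :: "nat \<Rightarrow> (nat \<Rightarrow> nat \<Rightarrow> complex) \<Rightarrow> bool" where
  "smooth_quadric n B \<longleftrightarrow> \<not> (\<exists>x. proj_point UNIV n x \<and> quad_form n B x = 0 \<and>
       (\<forall>k\<le>n. quad_partial n B k x = 0))"

text \<open>Hyperplanes given by linear forms a_1..a_m are in general position (m \<le> n+1):
  the linear forms are linearly independent.\<close>
definition general_position :: "nat \<Rightarrow> nat \<Rightarrow> (nat \<Rightarrow> nat \<Rightarrow> complex) \<Rightarrow> bool" where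
  "general_position n m a \<longleftrightarrow> (\<forall>c. (\<forall>j\<le>n. (\<Sum>i\<in>{1..m}. c i * a i j) = 0) \<longrightarrow>
       (\<forall>i\<in>{1..m}. c i = 0))"

definition divisor_pts :: "nat \<Rightarrow> (nat \<Rightarrow> nat \<Rightarrow> complex) \<Rightarrow> (nat \<Rightarrow> nat \<Rightarrow> complex)
    \<Rightarrow> (nat \<Rightarrow> complex) set" where
  "divisor_pts n a B = {x. proj_point UNIV n x \<and>
      ((\<exists>i\<in>{1..n-1}. lin_form n (a i) x = 0) \<or> quad_form n B x = 0)}"

definition line_quadric_pts :: "nat \<Rightarrow> (nat \<Rightarrow> nat \<Rightarrow> complex) \<Rightarrow> (nat \<Rightarrow> nat \<Rightarrow> complex)
    \<Rightarrow> (nat \<Rightarrow> complex) set" where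
  "line_quadric_pts n a B = {x. proj_point UNIV n x \<and>
      (\<forall>i\<in>{1..n-1}. lin_form n (a i) x = 0) \<and> quad_form n B x = 0}"

end

theory Submission
  imports Defs "HOL-Computational_Algebra.Polynomial" "HOL-Computational_Algebra.Primes"
begin

text \<open>
  Let \<open>x\<^sub>1, \<dots>, x\<^bsub>n-1\<^esub>\<close> be the equations of the hyperplanes. Completing them by coordinates
  \<open>u, w\<close> dual to the two points of \<open>L \<inter> Q\<close> and polar to the quadric, the equation of \<open>Q\<close> becomes
  \<open>q(x) + c u w\<close> with \<open>c \<noteq> 0\<close>. Hence for \<open>S\<close>-units \<open>x\<^sub>i, u, e\<close> the point
  \<open>(x : u : (e - q(x)) / (c u))\<close> has unit values \<open>x\<^sub>i\<close> and \<open>e\<close> under the equations of \<open>D\<close>, so it is integral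
  once \<open>S\<close> contains the finitely many places where some coefficient is not integral. This is a dominant
  family, so it suffices to let \<open>x\<^sub>i, u, e\<close> run through the powers of \<open>2\<close>, after adding the places
  above \<open>2\<close> to \<open>S\<close>; no extension of \<open>K\<close> is needed.

  That only finitely many places have to be added holds because places of \<open>K\<close> above one prime
  can be separated by elements of \<open>K\<close> which are linearly independent over the rationals.
\<close>

subsection \<open>Multivariate polynomials\<close>

definition monom_eval :: "(nat \<Rightarrow>\<^sub>0 nat) \<Rightarrow> (nat \<Rightarrow> complex) \<Rightarrow> complex" where
  "monom_eval m x = (\<Prod>i\<in>Poly_Mapping.keys m. x i ^ Poly_Mapping.lookup m i)"

text \<open>Two monomials can be multiplied factor by factor once both products run over a common
  index set; indices outside the support contribute exponent 0.\<close>

lemma monom_eval_superset: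
  assumes "finite A" "Poly_Mapping.keys m \<subseteq> A"
  shows "monom_eval m x = (\<Prod>i\<in>A. x i ^ Poly_Mapping.lookup m i)"
  unfolding monom_eval_def
  by (rule prod.mono_neutral_left) (use assms in \<open>auto simp: in_keys_iff\<close>)

lemma monom_eval_add: "monom_eval (m + m') x = monom_eval m x * monom_eval m' x"
proof -
  let ?A = "Poly_Mapping.keys m \<union> Poly_Mapping.keys m'"
  have "Poly_Mapping.keys (m + m') \<subseteq> ?A" by (rule Poly_Mapping.keys_add)
  then show ?thesis
    by (simp add: monom_eval_superset[of ?A] lookup_add power_add prod.distrib)
qed

lemma mpeval_superset:
  assumes "finite A" "Poly_Mapping.keys p \<subseteq> A"
  shows "mpeval p x = (\<Sum>m\<in>A. Poly_Mapping.lookup p m * monom_eval m x)"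
  unfolding mpeval_def monom_eval_def[symmetric]
  by (rule sum.mono_neutral_left) (use assms in \<open>auto simp: in_keys_iff\<close>)

lemma mpeval_zero [simp]: "mpeval 0 x = 0"
  by (simp add: mpeval_def)

lemma mpeval_add: "mpeval (p + q) x = mpeval p x + mpeval q x"
proof -
  let ?A = "Poly_Mapping.keys p \<union> Poly_Mapping.keys q"
  have "Poly_Mapping.keys (p + q) \<subseteq> ?A" by (rule Poly_Mapping.keys_add)
  then show ?thesis
    by (simp add: mpeval_superset[of ?A] lookup_add algebra_simps sum.distrib)
qed

lemma mpeval_sum: "mpeval (\<Sum>i\<in>I. p i) x = (\<Sum>i\<in>I. mpeval (p i) x)"
  by (induction I rule: infinite_finite_induct) (auto simp: mpeval_add)

lemma mpeval_single: "mpeval (Poly_Mapping.single m c) x = c * monom_eval m x"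
  by (subst mpeval_superset[of "{m}"]) auto

text \<open>Reduces multiplicativity of evaluation and additivity of degrees to products of single
  monomials, where exponents simply add.\<close>

lemma mpoly_as_sum: "p = (\<Sum>m\<in>Poly_Mapping.keys p. Poly_Mapping.single m (Poly_Mapping.lookup p m))"
  by (rule poly_mapping_eqI) (auto simp: lookup_sum lookup_single when_def in_keys_iff)

lemma mpeval_mult: "mpeval (p * q) x = mpeval p x * mpeval q x"
proof -
  have "mpeval (p * q) x = mpeval
     ((\<Sum>m\<in>Poly_Mapping.keys p. Poly_Mapping.single m (Poly_Mapping.lookup p m)) *
      (\<Sum>m\<in>Poly_Mapping.keys q. Poly_Mapping.single m (Poly_Mapping.lookup q m))) x"
    using mpoly_as_sum[of p] mpoly_as_sum[of q] by simp
  also have "\<dots> = mpeval p x * mpeval q x"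
    unfolding mpeval_superset[of "Poly_Mapping.keys p" p, simplified]
      mpeval_superset[of "Poly_Mapping.keys q" q, simplified]
    by (simp add: sum_product mpeval_sum mult_single mpeval_single monom_eval_add mult_ac)
  finally show ?thesis .
qed

text \<open>\<open>homogeneous_poly\<close> hides the degree behind an existential, but sums and
  products need it as an explicit parameter. Summing the exponents over all of \<open>{..n}\<close>
  rather than over the support makes degrees visibly additive.\<close>

definition homogeneous_of_degree :: "nat \<Rightarrow> complex set \<Rightarrow> nat \<Rightarrow> mpoly \<Rightarrow> bool" where
  "homogeneous_of_degree n R d p \<longleftrightarrow> (\<forall>m. Poly_Mapping.lookup p m \<in> R) \<and>
     (\<forall>m\<in>Poly_Mapping.keys p. Poly_Mapping.keys m \<subseteq> {..n} \<and>
        (\<Sum>i\<le>n. Poly_Mapping.lookup m i) = d)"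

lemma homogeneous_of_degree_imp_homogeneous_poly:
  assumes "homogeneous_of_degree n R d p"
  shows "homogeneous_poly n R p"
proof -
  have "(\<Sum>i\<in>Poly_Mapping.keys m. Poly_Mapping.lookup m i) = d" if "m \<in> Poly_Mapping.keys p" for m
  proof -
    have "(\<Sum>i\<in>Poly_Mapping.keys m. Poly_Mapping.lookup m i) = (\<Sum>i\<le>n. Poly_Mapping.lookup m i)"
      by (rule sum.mono_neutral_left)
        (use assms that in \<open>auto simp: homogeneous_of_degree_def in_keys_iff\<close>)
    then show ?thesis using assms that by (simp add: homogeneous_of_degree_def)
  qed
  then show ?thesis using assms
    unfolding homogeneous_of_degree_def homogeneous_poly_def by auto
qed

lemma sum_closed:
  assumes "(0::complex) \<in> R" "\<And>x y. x \<in> R \<Longrightarrow> y \<in> R \<Longrightarrow> x + y \<in> R" "\<And>i. i \<in> I \<Longrightarrow> f i \<in> R"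
  shows "sum f I \<in> R"
  using assms(3) by (induction I rule: infinite_finite_induct) (auto intro: assms(1,2))

lemma homogeneous_of_degree_single:
  assumes "0 \<in> R" "c \<in> R" "Poly_Mapping.keys m \<subseteq> {..n}" "(\<Sum>i\<le>n. Poly_Mapping.lookup m i) = d"
  shows "homogeneous_of_degree n R d (Poly_Mapping.single m c)"
  using assms by (auto simp: homogeneous_of_degree_def lookup_single when_def)

lemma homogeneous_of_degree_sum:
  assumes "0 \<in> R" "\<And>x y. x \<in> R \<Longrightarrow> y \<in> R \<Longrightarrow> x + y \<in> R"
    and "\<And>i. i \<in> I \<Longrightarrow> homogeneous_of_degree n R d (p i)"
  shows "homogeneous_of_degree n R d (\<Sum>i\<in>I. p i)"
  using assms(3)
proof (induction I rule: infinite_finite_induct)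
  case (insert i I)
  have "homogeneous_of_degree n R d (p i)" "homogeneous_of_degree n R d (\<Sum>i\<in>I. p i)"
    using insert by auto
  then show ?case using insert.hyps Poly_Mapping.keys_add[of "p i" "\<Sum>i\<in>I. p i"] assms(2)
    unfolding homogeneous_of_degree_def by (simp add: lookup_add) blast
qed (auto simp: homogeneous_of_degree_def assms(1))

lemma homogeneous_of_degree_mult:
  assumes R: "0 \<in> R" "\<And>x y. x \<in> R \<Longrightarrow> y \<in> R \<Longrightarrow> x + y \<in> R" "\<And>x y. x \<in> R \<Longrightarrow> y \<in> R \<Longrightarrow> x * y \<in> R"
    and p: "homogeneous_of_degree n R d p" and q: "homogeneous_of_degree n R e q"
  shows "homogeneous_of_degree n R (d + e) (p * q)"
proof -
  have *: "homogeneous_of_degree n R (d + e)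
     (Poly_Mapping.single m (Poly_Mapping.lookup p m) * Poly_Mapping.single m' (Poly_Mapping.lookup q m'))"
    if "m \<in> Poly_Mapping.keys p" "m' \<in> Poly_Mapping.keys q" for m m'
    unfolding mult_single
  proof (rule homogeneous_of_degree_single)
    show "Poly_Mapping.lookup p m * Poly_Mapping.lookup q m' \<in> R"
      using p q R(3) by (simp add: homogeneous_of_degree_def)
    show "Poly_Mapping.keys (m + m') \<subseteq> {..n}"
      using p q that Poly_Mapping.keys_add[of m m'] unfolding homogeneous_of_degree_def by blast
    show "(\<Sum>i\<le>n. Poly_Mapping.lookup (m + m') i) = d + e"
      using p q that by (simp add: homogeneous_of_degree_def lookup_add sum.distrib)
  qed (rule R)
  have "p * q = (\<Sum>m\<in>Poly_Mapping.keys p. \<Sum>m'\<in>Poly_Mapping.keys q.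
     Poly_Mapping.single m (Poly_Mapping.lookup p m) * Poly_Mapping.single m' (Poly_Mapping.lookup q m'))"
    using mpoly_as_sum[of p] mpoly_as_sum[of q] by (metis (no_types) sum_product)
  then show ?thesis
    by (auto intro!: homogeneous_of_degree_sum R *)
qed

section \<open>The equations of the divisor as homogeneous polynomials\<close>

definition lin_mpoly :: "nat \<Rightarrow> (nat \<Rightarrow> complex) \<Rightarrow> mpoly" where
  "lin_mpoly n a = (\<Sum>j\<le>n. Poly_Mapping.single (Poly_Mapping.single j 1) (a j))"

definition quad_mpoly :: "nat \<Rightarrow> (nat \<Rightarrow> nat \<Rightarrow> complex) \<Rightarrow> mpoly" where
  "quad_mpoly n B = (\<Sum>i\<le>n. \<Sum>j\<le>n.
     Poly_Mapping.single (Poly_Mapping.single i 1 + Poly_Mapping.single j 1) (B i j))"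

lemma monom_eval_var: "monom_eval (Poly_Mapping.single j 1) x = x j"
  by (simp add: monom_eval_def)

lemma mpeval_lin_mpoly: "mpeval (lin_mpoly n a) x = lin_form n a x"
  by (simp add: lin_mpoly_def lin_form_def mpeval_sum mpeval_single monom_eval_var del: One_nat_def)

lemma mpeval_quad_mpoly: "mpeval (quad_mpoly n B) x = quad_form n B x"
  by (simp add: quad_mpoly_def quad_form_def mpeval_sum mpeval_single monom_eval_var monom_eval_add
      mult.assoc del: One_nat_def)

lemma homogeneous_lin_mpoly:
  assumes "0 \<in> R" "\<And>x y. x \<in> R \<Longrightarrow> y \<in> R \<Longrightarrow> x + y \<in> R" "\<And>j. j \<le> n \<Longrightarrow> a j \<in> R"
  shows "homogeneous_of_degree n R 1 (lin_mpoly n a)"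
  unfolding lin_mpoly_def
  by (intro homogeneous_of_degree_sum homogeneous_of_degree_single assms)
    (auto simp: lookup_single when_def assms)

lemma homogeneous_quad_mpoly:
  assumes "0 \<in> R" "\<And>x y. x \<in> R \<Longrightarrow> y \<in> R \<Longrightarrow> x + y \<in> R" "\<And>i j. i \<le> n \<Longrightarrow> j \<le> n \<Longrightarrow> B i j \<in> R"
  shows "homogeneous_of_degree n R 2 (quad_mpoly n B)"
  unfolding quad_mpoly_def
proof (intro homogeneous_of_degree_sum homogeneous_of_degree_single assms)
  fix i j assume "i \<in> {..n}" "j \<in> {..n}"
  then show "i \<le> n" "j \<le> n"
    "(\<Sum>k\<le>n. Poly_Mapping.lookup (Poly_Mapping.single i 1 + Poly_Mapping.single j 1) k) = (2::nat)"
    by (auto simp: lookup_add lookup_single when_def sum.distrib)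
  show "Poly_Mapping.keys (Poly_Mapping.single i (1::nat) + Poly_Mapping.single j 1) \<subseteq> {..n}"
    using Poly_Mapping.keys_add[of "Poly_Mapping.single i (1::nat)" "Poly_Mapping.single j 1"]
      \<open>i \<in> {..n}\<close> \<open>j \<in> {..n}\<close> by auto
qed

text \<open>The product of all equations of the divisor vanishes on it, and it is the one element of
  the vanishing ideal that the integrality argument evaluates. There \<open>R\<close> is a valuation
  ring, and its closure properties keep the coefficients integral.\<close>

lemma exists_divisor_mpoly:
  assumes R: "0 \<in> R" "\<And>x y. x \<in> R \<Longrightarrow> y \<in> R \<Longrightarrow> x + y \<in> R" "\<And>x y. x \<in> R \<Longrightarrow> y \<in> R \<Longrightarrow> x * y \<in> R"
    and a: "\<And>i j. i \<in> I \<Longrightarrow> j \<le> n \<Longrightarrow> a i j \<in> R"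
    and B: "\<And>i j. i \<le> n \<Longrightarrow> j \<le> n \<Longrightarrow> B i j \<in> R"
    and "finite I"
  shows "\<exists>f d. homogeneous_of_degree n R d f \<and>
     (\<forall>x. mpeval f x = (\<Prod>i\<in>I. lin_form n (a i) x) * quad_form n B x)"
  using \<open>finite I\<close> a
proof (induction I rule: finite_induct)
  case empty
  show ?case using homogeneous_quad_mpoly[of R n B] R B
    by (intro exI[of _ "quad_mpoly n B"] exI[of _ 2]) (auto simp: mpeval_quad_mpoly)
next
  case (insert i I)
  then obtain f d where f: "homogeneous_of_degree n R d f"
     "\<forall>x. mpeval f x = (\<Prod>i\<in>I. lin_form n (a i) x) * quad_form n B x" by blast
  have "homogeneous_of_degree n R (1 + d) (lin_mpoly n (a i) * f)"
    by (intro homogeneous_of_degree_mult homogeneous_lin_mpoly f R insert.prems) auto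
  then show ?case using f insert.hyps
    by (intro exI[of _ "lin_mpoly n (a i) * f"] exI[of _ "1 + d"])
      (simp add: mpeval_mult mpeval_lin_mpoly)
qed

text \<open>Reduction modulo \<open>D\<close> recovers the lowest digit; after cancelling it and
  dividing by \<open>D\<close>, the remaining digits satisfy the same equation with one term
  fewer.\<close>

lemma digits_unique:
  fixes f g :: "nat \<Rightarrow> nat"
  assumes "\<And>i. i \<le> n \<Longrightarrow> f i < D" "\<And>i. i \<le> n \<Longrightarrow> g i < D"
    and "(\<Sum>i\<le>n. f i * D ^ i) = (\<Sum>i\<le>n. g i * D ^ i)" "i \<le> n"
  shows "f i = g i"
  using assms
proof (induction n arbitrary: f g i)
  case (Suc n)
  have *: "(\<Sum>i\<le>Suc n. h i * D ^ i) = h 0 + D * (\<Sum>i\<le>n. h (Suc i) * D ^ i)" for h :: "nat \<Rightarrow> nat"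
    unfolding sum.atMost_Suc_shift by (simp add: sum_distrib_left mult.left_commute)
  have eq: "f 0 + D * (\<Sum>i\<le>n. f (Suc i) * D ^ i) = g 0 + D * (\<Sum>i\<le>n. g (Suc i) * D ^ i)"
    using Suc.prems(3) unfolding * .
  have lt: "f 0 < D" "g 0 < D" using Suc.prems by auto
  have 0: "f 0 = g 0"
    using arg_cong[OF eq, of "\<lambda>x. x mod D"] lt by simp
  have "(\<Sum>i\<le>n. f (Suc i) * D ^ i) = (\<Sum>i\<le>n. g (Suc i) * D ^ i)"
    using eq 0 lt by simp
  then have "f (Suc k) = g (Suc k)" if "k \<le> n" for k
    using Suc.IH[of "\<lambda>i. f (Suc i)" "\<lambda>i. g (Suc i)" k] Suc.prems(1,2) that by auto
  then show ?case using 0 Suc.prems(4) by (cases i) auto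
qed auto

text \<open>Kronecker substitution \<open>X\<^sub>i = t ^ D ^ i\<close> with \<open>D\<close> larger than all
  exponents separates the monomials.\<close>
lemma mpoly_eq_0_if_vanishing:
  assumes keys: "\<And>m. m \<in> Poly_Mapping.keys f \<Longrightarrow> Poly_Mapping.keys m \<subseteq> {..n}"
    and zero: "\<And>x. mpeval f x = 0"
  shows "f = 0"
proof -
  have "finite (\<Union>m\<in>Poly_Mapping.keys f. Poly_Mapping.lookup m ` {..n})" by simp
  then obtain D where D: "\<And>k. k \<in> (\<Union>m\<in>Poly_Mapping.keys f. Poly_Mapping.lookup m ` {..n}) \<Longrightarrow> k < D"
    by (meson finite_nat_set_iff_bounded)
  \<comment> \<open>The exponent that \<open>t\<close> receives from \<open>m\<close>: the exponents
    of \<open>m\<close> read as digits in base \<open>D\<close>.\<close>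
  define enc where "enc m = (\<Sum>i\<le>n. Poly_Mapping.lookup m i * D ^ i)" for m
  have inj: "inj_on enc (Poly_Mapping.keys f)"
  proof (rule inj_onI)
    fix m m' assume m: "m \<in> Poly_Mapping.keys f" "m' \<in> Poly_Mapping.keys f" "enc m = enc m'"
    have "Poly_Mapping.lookup m i = Poly_Mapping.lookup m' i" if "i \<le> n" for i
      by (rule digits_unique[of n _ D]) (use m that D in \<open>auto simp: enc_def\<close>)
    moreover have "Poly_Mapping.lookup m i = Poly_Mapping.lookup m' i" if "\<not> i \<le> n" for i
      using keys[OF m(1)] keys[OF m(2)] that by (metis atMost_iff in_keys_iff subsetD)
    ultimately show "m = m'" by (intro poly_mapping_eqI) blast
  qed
  define P where "P = (\<Sum>m\<in>Poly_Mapping.keys f. monom (Poly_Mapping.lookup f m) (enc m))"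
  have "poly P t = 0" for t
  proof -
    have "monom_eval m (\<lambda>i. t ^ (D ^ i)) = t ^ enc m" if "m \<in> Poly_Mapping.keys f" for m
      using keys[OF that]
      by (subst monom_eval_superset[of "{..n}"])
         (auto simp: enc_def power_sum power_mult[symmetric] mult.commute)
    then have "poly P t = mpeval f (\<lambda>i. t ^ (D ^ i))"
      by (simp add: P_def poly_sum poly_monom mpeval_superset[of "Poly_Mapping.keys f"])
    then show ?thesis using zero by simp
  qed
  then have P0: "P = 0" using poly_all_0_iff_0 by blast
  have "Poly_Mapping.lookup f m = 0" for m
  proof (cases "m \<in> Poly_Mapping.keys f")
    case True
    \<comment> \<open>By injectivity of \<open>enc\<close> on the support, only \<open>m\<close>
      itself contributes to this coefficient.\<close>
    have "coeff P (enc m) = (\<Sum>k\<in>Poly_Mapping.keys f. if k = m then Poly_Mapping.lookup f k else 0)"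
      unfolding P_def coeff_sum using inj True
      by (intro sum.cong) (auto simp: inj_on_eq_iff)
    then show ?thesis using P0 True by simp
  qed (simp add: in_keys_iff)
  then show ?thesis by (intro poly_mapping_eqI) simp
qed

subsection \<open>Polynomial functions\<close>

text \<open>Polynomiality is kept as a property of functions, so that it can be read off an explicit
  formula by closure rules alone.\<close>

definition polyfun :: "(complex \<Rightarrow> complex) \<Rightarrow> bool" where
  "polyfun g \<longleftrightarrow> (\<exists>p. \<forall>t. g t = poly p t)"

lemma polyfun_const [intro]: "polyfun (\<lambda>t. c)"
  unfolding polyfun_def by (rule exI[of _ "[:c:]"]) simp

lemma polyfun_ident [intro]: "polyfun (\<lambda>t. t)"
  unfolding polyfun_def by (rule exI[of _ "[:0, 1:]"]) simp

lemma polyfun_add [intro]: "polyfun f \<Longrightarrow> polyfun g \<Longrightarrow> polyfun (\<lambda>t. f t + g t)"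
  unfolding polyfun_def by (metis poly_add)

lemma polyfun_diff [intro]: "polyfun f \<Longrightarrow> polyfun g \<Longrightarrow> polyfun (\<lambda>t. f t - g t)"
  unfolding polyfun_def by (metis poly_diff)

lemma polyfun_mult [intro]: "polyfun f \<Longrightarrow> polyfun g \<Longrightarrow> polyfun (\<lambda>t. f t * g t)"
  unfolding polyfun_def by (metis poly_mult)

lemma polyfun_divide_const [intro]: "polyfun f \<Longrightarrow> polyfun (\<lambda>t. f t / c)"
  using polyfun_mult[of f "\<lambda>t. inverse c"] by (auto simp: divide_inverse)

lemma polyfun_power [intro]: "polyfun f \<Longrightarrow> polyfun (\<lambda>t. f t ^ k)"
  unfolding polyfun_def by (metis poly_power)

lemma polyfun_sum [intro]: "(\<And>i. i \<in> I \<Longrightarrow> polyfun (f i)) \<Longrightarrow> polyfun (\<lambda>t. \<Sum>i\<in>I. f i t)"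
  by (induction I rule: infinite_finite_induct) auto

lemma polyfun_prod [intro]: "(\<And>i. i \<in> I \<Longrightarrow> polyfun (f i)) \<Longrightarrow> polyfun (\<lambda>t. \<Prod>i\<in>I. f i t)"
  by (induction I rule: infinite_finite_induct) auto

lemma polyfun_fun_upd [intro]: "polyfun (\<lambda>t. (z(i := t)) k)"
  by (cases "k = i") auto

lemma polyfun_mpeval:
  assumes "\<And>j. polyfun (\<lambda>t. X t j)"
  shows "polyfun (\<lambda>t. mpeval f (X t))"
  unfolding mpeval_def by (intro polyfun_sum polyfun_prod polyfun_mult polyfun_power polyfun_const assms)

lemma polyfun_eq_0_if_infinite_zeros:
  assumes "polyfun g" "infinite A" "\<And>t. t \<in> A \<Longrightarrow> g t = 0"
  shows "g t = 0"
proof -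
  obtain p where p: "\<And>t. g t = poly p t" using assms(1) unfolding polyfun_def by auto
  have "A \<subseteq> {t. poly p t = 0}" using assms(3) p by auto
  then have "p = 0" using assms(2) poly_roots_finite finite_subset by blast
  then show ?thesis using p by simp
qed

text \<open>The coordinates are released from \<open>A\<close> one at a time, the last one first:
  with the others fixed, \<open>G\<close> is a polynomial in one variable with infinitely many
  zeros.\<close>

lemma separately_polyfun_eq_0:
  assumes G: "\<And>z i. polyfun (\<lambda>t. G (z(i := t)))" and A: "infinite A"
    and "\<And>z. (\<And>i. i < (N::nat) \<Longrightarrow> z i \<in> A) \<Longrightarrow> G z = 0"
  shows "G z = 0"
  using assms(3)
proof (induction N arbitrary: z)
  case (Suc N)
  show ?case
  proof (rule Suc.IH)
    fix z assume z: "\<And>i. i < N \<Longrightarrow> z i \<in> A"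
    have "G (z(N := t)) = 0" if "t \<in> A" for t
      by (rule Suc.prems) (use z that in \<open>auto simp: less_Suc_eq\<close>)
    then have "G (z(N := z N)) = 0"
      by (rule polyfun_eq_0_if_infinite_zeros[OF G A])
    then show "G z = 0" by simp
  qed
qed simp

subsection \<open>Non-archimedean absolute values\<close>

context
  fixes F assumes F: "subfield F"
begin

lemma subfield_zero: "0 \<in> F" and subfield_one: "1 \<in> F"
  and subfield_add: "x \<in> F \<Longrightarrow> y \<in> F \<Longrightarrow> x + y \<in> F"
  and subfield_mult: "x \<in> F \<Longrightarrow> y \<in> F \<Longrightarrow> x * y \<in> F"
  and subfield_uminus: "x \<in> F \<Longrightarrow> - x \<in> F"
  using F by (auto simp: subfield_def)

lemma subfield_inverse: "x \<in> F \<Longrightarrow> inverse x \<in> F"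
  using F by (cases "x = 0") (auto simp: subfield_def)

lemma subfield_diff: "x \<in> F \<Longrightarrow> y \<in> F \<Longrightarrow> x - y \<in> F"
  using subfield_add[of x "- y"] subfield_uminus[of y] by simp

lemma subfield_divide: "x \<in> F \<Longrightarrow> y \<in> F \<Longrightarrow> x / y \<in> F"
  using subfield_mult[of x "inverse y"] subfield_inverse[of y] by (simp add: divide_inverse)

lemma subfield_power: "x \<in> F \<Longrightarrow> x ^ k \<in> F"
  by (induction k) (auto intro: subfield_one subfield_mult)

lemma subfield_power_int: "x \<in> F \<Longrightarrow> x powi k \<in> F"
  by (auto simp: power_int_def intro: subfield_power subfield_inverse)

lemma subfield_of_nat: "of_nat k \<in> F"
  by (induction k) (auto intro: subfield_zero subfield_one subfield_add)

lemma subfield_of_int: "of_int k \<in> F"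
  by (cases k rule: int_cases2) (auto intro: subfield_of_nat subfield_uminus)

lemma subfield_sum: "(\<And>i. i \<in> I \<Longrightarrow> f i \<in> F) \<Longrightarrow> sum f I \<in> F"
  by (induction I rule: infinite_finite_induct) (auto intro: subfield_zero subfield_add)

end

text \<open>Fixes one absolute value as the representative of a finite place; it is interpreted once
  per place when several places are compared.\<close>

locale nonarch_field =
  fixes F :: "complex set" and \<phi> :: "complex \<Rightarrow> real"
  assumes F: "subfield F" and abs: "abs_val F \<phi>" and nonarch: "nonarch F \<phi>"
begin

lemmas closed = subfield_zero[OF F] subfield_one[OF F] subfield_add[OF F] subfield_mult[OF F]
  subfield_uminus[OF F] subfield_inverse[OF F] subfield_divide[OF F] subfield_diff[OF F]
  subfield_power[OF F] subfield_power_int[OF F] subfield_of_nat[OF F] subfield_of_int[OF F]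
  subfield_sum[OF F]

lemma val_zero [simp]: "\<phi> 0 = 0"
  using abs closed(1) by (auto simp: abs_val_def)

lemma val_mult: "x \<in> F \<Longrightarrow> y \<in> F \<Longrightarrow> \<phi> (x * y) = \<phi> x * \<phi> y"
  using abs by (auto simp: abs_val_def)

lemma val_nonneg [simp]: "\<phi> x \<ge> 0"
  using abs by (cases "x \<in> F") (auto simp: abs_val_def)

lemma val_pos: "x \<in> F \<Longrightarrow> x \<noteq> 0 \<Longrightarrow> \<phi> x > 0"
  using abs val_nonneg[of x] by (auto simp: abs_val_def less_le)

lemma val_one [simp]: "\<phi> 1 = 1"
  using val_mult[of 1 1] val_pos[of 1] closed(2) by simp

lemma val_add: "x \<in> F \<Longrightarrow> y \<in> F \<Longrightarrow> \<phi> (x + y) \<le> max (\<phi> x) (\<phi> y)"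
  using nonarch by (auto simp: nonarch_def)

lemma val_uminus [simp]:
  assumes "x \<in> F"
  shows "\<phi> (- x) = \<phi> x"
proof -
  have "\<phi> (- 1) * \<phi> (- 1) = 1"
    using val_mult[of "- 1" "- 1"] closed by simp
  then have "\<phi> (- 1) = 1"
    using val_nonneg[of "- 1"] by (simp add: square_eq_1_iff)
  then show ?thesis using val_mult[of "- 1" x] closed assms by simp
qed

lemma val_inverse:
  assumes "x \<in> F"
  shows "\<phi> (inverse x) = inverse (\<phi> x)"
proof (cases "x = 0")
  case False
  then have "\<phi> x * \<phi> (inverse x) = 1"
    using val_mult[of x "inverse x"] assms by (simp add: closed)
  then show ?thesis by (metis inverse_unique)
qed simp

lemma val_divide: "x \<in> F \<Longrightarrow> y \<in> F \<Longrightarrow> \<phi> (x / y) = \<phi> x / \<phi> y"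
  by (simp add: divide_inverse val_mult val_inverse closed)

lemma val_power: "x \<in> F \<Longrightarrow> \<phi> (x ^ k) = \<phi> x ^ k"
  by (induction k) (auto simp: val_mult closed)

lemma val_power_int: "x \<in> F \<Longrightarrow> \<phi> (x powi k) = \<phi> x powi k"
  by (auto simp: power_int_def val_power val_inverse closed)

lemma val_prod: "(\<And>i. i \<in> I \<Longrightarrow> f i \<in> F) \<Longrightarrow> \<phi> (\<Prod>i\<in>I. f i) = (\<Prod>i\<in>I. \<phi> (f i)) \<and> (\<Prod>i\<in>I. f i) \<in> F"
  by (induction I rule: infinite_finite_induct) (auto simp: val_mult closed)

lemma val_of_nat: "\<phi> (of_nat k) \<le> 1"
proof (induction k)
  case (Suc k)
  then show ?case using val_add[of 1 "of_nat k"] closed by (simp del: of_nat_Suc add: of_nat_Suc)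
qed simp

lemma val_of_int_eq: "\<phi> (of_int k) = \<phi> (of_nat (nat \<bar>k\<bar>))"
  by (cases k rule: int_cases2) (auto simp: closed)

lemma val_of_int: "\<phi> (of_int k) \<le> 1"
  unfolding val_of_int_eq by (rule val_of_nat)

lemma val_add_less: "x \<in> F \<Longrightarrow> y \<in> F \<Longrightarrow> \<phi> x < M \<Longrightarrow> \<phi> y < M \<Longrightarrow> \<phi> (x + y) < M"
  using val_add[of x y] by linarith

text \<open>The ultrametric inequality for \<open>y\<close> as the sum of \<open>x + y\<close> and
  \<open>- x\<close> rules out a drop in value, because \<open>x\<close> is too small to account for
  \<open>y\<close>.\<close>

lemma val_add_eq:
  assumes "x \<in> F" "y \<in> F" "\<phi> x < \<phi> y"
  shows "\<phi> (x + y) = \<phi> y"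
  using val_add[of x y] val_add[of "x + y" "- x"] assms by (simp add: closed)

lemma val_sum_less:
  assumes "\<And>i. i \<in> I \<Longrightarrow> f i \<in> F" "\<And>i. i \<in> I \<Longrightarrow> \<phi> (f i) < M" "M > 0"
  shows "\<phi> (sum f I) < M"
  using assms(1,2)
  by (induction I rule: infinite_finite_induct) (auto simp: \<open>M > 0\<close> intro!: val_add_less closed)

text \<open>The value is multiplicative and at most 1 on natural numbers. A prime factor of value 1
  can be divided out without changing the value of the rest, so some prime factor must carry the
  small value.\<close>

lemma ex_prime_val_less_1:
  assumes "\<phi> (of_nat N) < 1" "N > 0"
  shows "\<exists>p. prime p \<and> p dvd N \<and> \<phi> (of_nat p) < 1"
  using assms
proof (induction N rule: less_induct)
  case (less N)
  then have "N \<noteq> 1" by auto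
  then obtain p where p: "prime p" "p dvd N" using prime_factor_nat by blast
  then obtain M where M: "N = p * M" by auto
  show ?case
  proof (cases "\<phi> (of_nat p) < 1")
    case False
    then have "\<phi> (of_nat p) = 1" using val_of_nat[of p] by simp
    then have "\<phi> (of_nat M) < 1" using less.prems val_mult[of "of_nat p" "of_nat M"] M closed by simp
    moreover have "M < N" "M > 0" using M less.prems p prime_gt_1_nat[of p] by auto
    ultimately show ?thesis using less.IH[of M] M by (meson dvd_mult)
  qed (use p in auto)
qed

text \<open>The integers of value below 1 form an ideal. If \<open>p\<close> and \<open>k\<close>
  were coprime, a Bezout relation would put 1 into it.\<close>

lemma prime_dvd_if_val_less_1:
  assumes p: "prime (p::nat)" "\<phi> (of_nat p) < 1" and k: "\<phi> (of_int k) < 1"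
  shows "int p dvd k"
proof (rule ccontr)
  assume "\<not> int p dvd k"
  then have "coprime (int p) k" using p(1) by (simp add: prime_imp_coprime)
  then obtain a b where ab: "a * int p + b * k = 1"
    using bezout_int[of "int p" k] by auto
  have less: "\<phi> (of_int (a * c)) < 1" if "\<phi> (of_int c) < 1" for a c
    using that val_of_int[of a] val_nonneg[of "of_int c"] val_nonneg[of "of_int a"]
      mult_left_le_one_le[of "\<phi> (of_int c)" "\<phi> (of_int a)"]
    by (simp add: val_mult closed)
  have "\<phi> (of_int (a * int p) + of_int (b * k)) < 1"
    by (intro val_add_less closed less) (use p k in auto)
  then show False
    unfolding of_int_add[symmetric] ab by simp
qed

end

section \<open>Equivalence of absolute values\<close>

lemma ln_powi: "x > 0 \<Longrightarrow> ln (x powi m) = of_int m * ln x" for x :: real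
  by (simp flip: powr_real_of_int')

text \<open>Every \<open>x\<close> is measured against a fixed \<open>y\<close> of value below 1.
  Testing the implication on \<open>x ^ n * y powi m\<close> shows that the two ratios of logarithms
  of the values of \<open>x\<close> and \<open>y\<close> lie on the same side of every rational
  number, hence agree. The exponent is the ratio of the two logarithms at \<open>y\<close>.\<close>

lemma abs_values_equivalent:
  assumes "nonarch_field F \<phi>" "nonarch_field F \<psi>" "nontrivial_abs F \<phi>"
    and imp: "\<And>x. x \<in> F \<Longrightarrow> \<phi> x < 1 \<Longrightarrow> \<psi> x < 1"
  shows "\<exists>c>0. \<forall>x\<in>F. \<psi> x = \<phi> x powr c"
proof -
  interpret P: nonarch_field F \<phi> by fact
  interpret Q: nonarch_field F \<psi> by fact
  obtain y0 where y0: "y0 \<in> F" "y0 \<noteq> 0" "\<phi> y0 \<noteq> 1"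
    using assms(3) by (auto simp: nontrivial_abs_def)
  obtain y where y: "y \<in> F" "y \<noteq> 0" "\<phi> y < 1"
  proof (cases "\<phi> y0 < 1")
    case False
    then have "\<phi> (inverse y0) < 1" using y0 by (simp add: P.val_inverse inverse_less_1_iff)
    then show ?thesis using that[of "inverse y0"] y0 by (auto simp: P.closed)
  qed (use y0 that in auto)
  define A where "A = ln (\<phi> y)"
  define C where "C = ln (\<psi> y)"
  have A: "A < 0" using y P.val_pos by (simp add: A_def)
  have C: "C < 0" using y Q.val_pos imp[of y] by (simp add: C_def)
  have neg: "of_nat n * ln (\<psi> x) + of_int m * C < 0"
    if x: "x \<in> F" "x \<noteq> 0" and lt: "of_nat n * ln (\<phi> x) + of_int m * A < 0" for x n m
  proof -
    let ?z = "x ^ n * y powi m"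
    have z: "?z \<in> F" "?z \<noteq> 0" using x y by (auto simp: P.closed)
    have "ln (\<phi> ?z) = of_nat n * ln (\<phi> x) + of_int m * A"
      using P.val_pos[OF x] P.val_pos[OF y(1,2)] x y
      by (simp add: P.val_mult P.val_power P.val_power_int P.closed ln_mult ln_realpow A_def ln_powi)
    moreover have "ln (\<psi> ?z) = of_nat n * ln (\<psi> x) + of_int m * C"
      using Q.val_pos[OF x] Q.val_pos[OF y(1,2)] x y
      by (simp add: Q.val_mult Q.val_power Q.val_power_int Q.closed ln_mult ln_realpow C_def ln_powi)
    ultimately show ?thesis
      using imp[OF z(1)] lt P.val_pos[OF z] Q.val_pos[OF z] by (metis ln_less_zero_iff)
  qed
  \<comment> \<open>Replacing \<open>x\<close> and \<open>m\<close> by \<open>inverse x\<close> and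
    \<open>- m\<close> reverses all signs, so the one-sided hypothesis also transfers
    positivity.\<close>
  have pos: "of_nat n * ln (\<psi> x) + of_int m * C > 0"
    if x: "x \<in> F" "x \<noteq> 0" and lt: "of_nat n * ln (\<phi> x) + of_int m * A > 0" for x n m
    using neg[of "inverse x" n "- m"] x lt
    by (simp add: P.closed P.val_inverse Q.val_inverse ln_inverse P.val_pos Q.val_pos)
  have eq: "ln (\<psi> x) / C = ln (\<phi> x) / A" if x: "x \<in> F" "x \<noteq> 0" for x
  proof (rule ccontr)
    let ?r = "ln (\<phi> x) / A" let ?s = "ln (\<psi> x) / C"
    assume "?s \<noteq> ?r"
    then obtain q :: rat where q: "?r < of_rat q \<and> of_rat q < ?s \<or> ?s < of_rat q \<and> of_rat q < ?r"
      by (metis linorder_neqE of_rat_dense)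
    obtain m k where mk: "q = of_int m / of_int k" "k > 0"
      by (metis Fract_of_int_quotient Rat_cases)
    define n where "n = nat k"
    have n: "(of_rat q :: real) = of_int m / of_nat n" "n > 0"
      using mk by (auto simp: n_def of_rat_divide)
    \<comment> \<open>Since \<open>A\<close> and \<open>C\<close> are negative, both expressions
      have the opposite sign to the difference of their ratio and \<open>q\<close>. As
      \<open>q\<close> lies strictly between the ratios, the signs disagree, against
      \<open>pos\<close> or \<open>neg\<close>.\<close>
    have r: "of_nat n * ln (\<phi> x) + of_int (- m) * A = A * of_nat n * (?r - of_rat q)"
      using A n by (simp add: field_simps)
    have s: "of_nat n * ln (\<psi> x) + of_int (- m) * C = C * of_nat n * (?s - of_rat q)"
      using C n by (simp add: field_simps)
    have An: "A * of_nat n < 0" "C * of_nat n < 0" using A C n by (auto simp: mult_less_0_iff)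
    from q show False
    proof (elim disjE conjE)
      assume "?r < of_rat q" "of_rat q < ?s"
      then have "A * of_nat n * (?r - of_rat q) > 0" "C * of_nat n * (?s - of_rat q) < 0"
        using An by (auto simp: mult_less_0_iff zero_less_mult_iff)
      then show False using pos[OF x, of n "- m"] r s by linarith
    next
      assume "?s < of_rat q" "of_rat q < ?r"
      then have "A * of_nat n * (?r - of_rat q) < 0" "C * of_nat n * (?s - of_rat q) > 0"
        using An by (auto simp: mult_less_0_iff zero_less_mult_iff)
      then show False using neg[OF x, of n "- m"] r s by linarith
    qed
  qed
  have "\<psi> x = \<phi> x powr (C / A)" if "x \<in> F" for x
  proof (cases "x = 0")
    case False
    have "ln (\<psi> x) = C / A * ln (\<phi> x)" using eq[OF that False] A C by (simp add: field_simps)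
    then have "exp (ln (\<psi> x)) = exp (C / A * ln (\<phi> x))" by (rule arg_cong)
    then show ?thesis
      using P.val_pos[OF that False] Q.val_pos[OF that False] by (simp add: powr_def)
  qed simp
  moreover have "C / A > 0" using A C by (simp add: divide_neg_neg)
  ultimately show ?thesis by blast
qed

subsection \<open>Places\<close>

text \<open>Passing to another representative replaces an exponent \<open>d\<close> by
  \<open>d / c\<close> or \<open>c * d\<close>, so every member generates the same class.\<close>

lemma place_eq_class:
  assumes "subfield F" "place F v" "\<phi> \<in> v"
  shows "v = {\<psi>. abs_val F \<psi> \<and> (\<exists>c>0. \<forall>x\<in>F. \<psi> x = \<phi> x powr c)}"
proof -
  obtain \<phi>0 where \<phi>0: "abs_val F \<phi>0"
    "v = {\<psi>. abs_val F \<psi> \<and> (\<exists>c>0. \<forall>x\<in>F. \<psi> x = \<phi>0 x powr c)}"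
    using assms(2) by (auto simp: place_def)
  obtain c where c: "c > 0" "\<forall>x\<in>F. \<phi> x = \<phi>0 x powr c" using assms(3) \<phi>0(2) by auto
  have inv: "\<phi>0 x = \<phi> x powr (1 / c)" if "x \<in> F" for x
    using c that \<phi>0(1) by (simp add: powr_powr abs_val_def)
  have "(\<exists>d>0. \<forall>x\<in>F. \<psi> x = \<phi>0 x powr d) \<longleftrightarrow> (\<exists>d>0. \<forall>x\<in>F. \<psi> x = \<phi> x powr d)" for \<psi>
  proof
    assume "\<exists>d>0. \<forall>x\<in>F. \<psi> x = \<phi>0 x powr d"
    then obtain d where "d > 0" "\<forall>x\<in>F. \<psi> x = \<phi>0 x powr d" by auto
    then show "\<exists>d>0. \<forall>x\<in>F. \<psi> x = \<phi> x powr d"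
      using c(1) by (intro exI[of _ "1 / c * d"]) (simp add: inv powr_powr)
  next
    assume "\<exists>d>0. \<forall>x\<in>F. \<psi> x = \<phi> x powr d"
    then obtain d where "d > 0" "\<forall>x\<in>F. \<psi> x = \<phi> x powr d" by auto
    then show "\<exists>d>0. \<forall>x\<in>F. \<psi> x = \<phi>0 x powr d"
      using c by (intro exI[of _ "c * d"]) (simp add: powr_powr)
  qed
  then show ?thesis using \<phi>0(2) by simp
qed

lemma place_nonempty:
  assumes "place F v"
  shows "\<exists>\<phi>. \<phi> \<in> v"
proof -
  obtain \<phi> where \<phi>: "abs_val F \<phi>"
    "v = {\<psi>. abs_val F \<psi> \<and> (\<exists>c>0. \<forall>x\<in>F. \<psi> x = \<phi> x powr c)}"
    using assms by (auto simp: place_def)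
  then have "\<phi> \<in> v" by (auto simp: abs_val_def intro!: exI[of _ 1])
  then show ?thesis by blast
qed

lemma place_nontrivial:
  assumes "place F v" "\<phi> \<in> v"
  shows "nontrivial_abs F \<phi>"
proof -
  obtain \<phi>0 c x where \<phi>0: "abs_val F \<phi>0" "x \<in> F" "x \<noteq> 0" "\<phi>0 x \<noteq> 1" "c > 0" "\<forall>x\<in>F. \<phi> x = \<phi>0 x powr c"
    using assms by (auto simp: place_def nontrivial_abs_def)
  have "\<phi>0 x > 0" using \<phi>0 by (auto simp: abs_val_def less_le)
  then have "\<phi> x \<noteq> 1" using \<phi>0 by (auto simp: powr_eq_one_iff_gen)
  then show ?thesis using \<phi>0 by (auto simp: nontrivial_abs_def)
qed

lemma finite_place_nonarch_field:
  assumes "subfield F" "finite_place F v" "\<phi> \<in> v"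
  shows "nonarch_field F \<phi>"
  using assms by unfold_locales (auto simp: finite_place_def place_def)

text \<open>\<open>val_ring\<close> and \<open>val_max_ideal\<close> only ask for some member of the
  place. Members are positive powers of each other, and such powers preserve comparison with 1, so
  any chosen representative decides.\<close>

lemma finite_place_val_ring_iff:
  assumes "subfield F" "finite_place F v" "\<phi> \<in> v" "x \<in> F"
  shows "x \<in> val_ring F v \<longleftrightarrow> \<phi> x \<le> 1" and "x \<in> val_max_ideal F v \<longleftrightarrow> \<phi> x < 1"
proof -
  interpret nonarch_field F \<phi> by (rule finite_place_nonarch_field) (use assms in auto)
  have v: "v = {\<psi>. abs_val F \<psi> \<and> (\<exists>c>0. \<forall>x\<in>F. \<psi> x = \<phi> x powr c)}"
    using place_eq_class assms by (auto simp: finite_place_def)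
  have "\<psi> x \<le> 1 \<longleftrightarrow> \<phi> x \<le> 1" "\<psi> x < 1 \<longleftrightarrow> \<phi> x < 1" if \<psi>: "\<psi> \<in> v" for \<psi>
  proof -
    obtain c where c: "c > 0" "\<psi> x = \<phi> x powr c" using \<psi> v assms(4) by auto
    show "\<psi> x < 1 \<longleftrightarrow> \<phi> x < 1"
      using c powr_less_one[of c "\<phi> x"] ge_one_powr_ge_zero[of "\<phi> x" c]
        powr_less_mono2[of c "\<phi> x" 1] val_nonneg[of x]
      by (smt (verit) powr_one_eq_one)
    show "\<psi> x \<le> 1 \<longleftrightarrow> \<phi> x \<le> 1"
      using c powr_less_mono2[of c 1 "\<phi> x"] powr_mono2[of c "\<phi> x" 1] val_nonneg[of x]
      by (smt (verit) powr_one_eq_one)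
  qed
  then show "x \<in> val_ring F v \<longleftrightarrow> \<phi> x \<le> 1" and "x \<in> val_max_ideal F v \<longleftrightarrow> \<phi> x < 1"
    using assms(3,4) unfolding val_ring_def val_max_ideal_def by blast+
qed

text \<open>If small values at \<open>v\<close> forced small values at \<open>w\<close>, the places
  would coincide by \<open>abs_values_equivalent\<close>. So some \<open>a\<close> is small at
  \<open>v\<close> but not at \<open>w\<close>, some \<open>b\<close> behaves the other way round,
  and \<open>b / a\<close> separates.\<close>

lemma distinct_places_separated:
  assumes "subfield F" "finite_place F v" "finite_place F w" "v \<noteq> w" "\<phi> \<in> v" "\<psi> \<in> w"
  shows "\<exists>x\<in>F. \<phi> x > 1 \<and> \<psi> x < 1"
proof -
  have half: "\<exists>a\<in>F. \<phi> a < 1 \<and> \<psi> a \<ge> 1"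
    if "finite_place F v" "finite_place F w" "v \<noteq> w" "\<phi> \<in> v" "\<psi> \<in> w" for v w \<phi> \<psi>
  proof (rule ccontr)
    assume "\<not> ?thesis"
    then have "\<exists>c>0. \<forall>x\<in>F. \<psi> x = \<phi> x powr c"
      using that assms(1) abs_values_equivalent[of F \<phi> \<psi>] finite_place_nonarch_field
        place_nontrivial[of F v \<phi>] by (auto simp: finite_place_def not_le)
    moreover have "abs_val F \<psi>"
      using finite_place_nonarch_field[of F w \<psi>] that assms(1) by (simp add: nonarch_field_def)
    ultimately have "\<psi> \<in> v"
      using place_eq_class[of F v \<phi>] assms(1) that by (auto simp: finite_place_def)
    then show False
      using place_eq_class[of F v \<psi>] place_eq_class[of F w \<psi>] that assms(1)
      by (simp add: finite_place_def)
  qed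
  obtain a where a: "a \<in> F" "\<phi> a < 1" "\<psi> a \<ge> 1" using half[of v w \<phi> \<psi>] assms by auto
  obtain b where b: "b \<in> F" "\<psi> b < 1" "\<phi> b \<ge> 1" using half[of w v \<psi> \<phi>] assms by auto
  interpret P: nonarch_field F \<phi> by (rule finite_place_nonarch_field) (use assms in auto)
  interpret Q: nonarch_field F \<psi> by (rule finite_place_nonarch_field) (use assms in auto)
  have "a \<noteq> 0" using a by auto
  then have "\<phi> a > 0" using a P.val_pos by simp
  then have "\<phi> (b / a) > 1" "\<psi> (b / a) < 1"
    using a b by (auto simp: P.val_divide Q.val_divide field_simps)
  then show ?thesis using a b P.closed(7)[of b a] by blast
qed

text \<open>Artin and Whaples: \<open>x ^ k / (1 + x ^ k)\<close> is close to \<open>1\<close> where \<open>\<bar>x\<bar> > 1\<close> and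
  close to \<open>0\<close> where \<open>\<bar>x\<bar> < 1\<close>.\<close>
lemma place_separated_from_finite_set:
  assumes F: "subfield F" and "finite V" "finite_place F v" "v \<notin> V" "\<And>w. w \<in> V \<Longrightarrow> finite_place F w"
    and \<phi>: "\<And>w. finite_place F w \<Longrightarrow> \<phi> w \<in> w"
  shows "\<exists>x\<in>F. \<phi> v x > 1 \<and> (\<forall>w\<in>V. \<phi> w x < 1)"
  using assms(2,4,5)
proof (induction V rule: finite_induct)
  case empty
  interpret nonarch_field F "\<phi> v" by (rule finite_place_nonarch_field) (use assms in auto)
  obtain x where x: "x \<in> F" "x \<noteq> 0" "\<phi> v x \<noteq> 1"
    using place_nontrivial[of F v "\<phi> v"] assms \<phi>
    by (auto simp: finite_place_def nontrivial_abs_def)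
  show ?case
  proof (cases "\<phi> v x > 1")
    case False
    then have "\<phi> v (inverse x) > 1"
      using x val_pos[of x] by (simp add: val_inverse one_less_inverse)
    then show ?thesis using x closed(6)[of x] by blast
  qed (use x in blast)
next
  case (insert w V)
  then obtain x where x: "x \<in> F" "\<phi> v x > 1" "\<And>u. u \<in> V \<Longrightarrow> \<phi> u x < 1" by auto
  have w: "finite_place F w" "v \<noteq> w" using insert.prems by auto
  obtain z where z: "z \<in> F" "\<phi> v z > 1" "\<phi> w z < 1"
    using distinct_places_separated[OF F assms(3) w \<phi>[OF assms(3)] \<phi>[OF w(1)]] by auto
  have nf: "nonarch_field F (\<phi> u)" if "u \<in> insert v (insert w V)" for u
    using finite_place_nonarch_field[OF F _ \<phi>] that insert.prems assms(3) by auto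
  interpret v: nonarch_field F "\<phi> v" by (rule nf) simp
  interpret w: nonarch_field F "\<phi> w" by (rule nf) simp
  \<comment> \<open>At every place of \<open>V\<close> the value of \<open>x\<close> is below 1, so
    high powers outweigh a possibly large value of \<open>z\<close>; finiteness of \<open>V\<close>
    yields one exponent for all.\<close>
  have "\<forall>\<^sub>F k in sequentially. \<forall>u\<in>V. \<phi> u x ^ k * \<phi> u z < 1"
  proof (rule eventually_ball_finite[OF insert.hyps(1)], rule ballI)
    fix u assume u: "u \<in> V"
    interpret u: nonarch_field F "\<phi> u" by (rule nf) (use u in simp)
    have "(\<lambda>k. \<phi> u x ^ k * \<phi> u z) \<longlonglongrightarrow> 0"
      by (intro tendsto_mult_left_zero LIMSEQ_power_zero) (use x u in simp)
    then show "\<forall>\<^sub>F k in sequentially. \<phi> u x ^ k * \<phi> u z < 1"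
      by (rule order_tendstoD) simp
  qed
  \<comment> \<open>Positivity of \<open>k\<close> keeps the powers of \<open>x\<close> strictly
    above or below 1 when they are compared with the summand 1 in \<open>1 + x ^ k\<close>.\<close>
  then have "\<forall>\<^sub>F k in sequentially. (\<forall>u\<in>V. \<phi> u x ^ k * \<phi> u z < 1) \<and> k > 0"
    by (rule eventually_conj) (rule eventually_gt_at_top)
  then obtain k where k: "\<And>u. u \<in> V \<Longrightarrow> \<phi> u x ^ k * \<phi> u z < 1" "k > 0"
    unfolding eventually_sequentially by blast
  show ?case
  proof (cases "\<phi> w x \<le> 1")
    case True
    have "1 < 1 * \<phi> v z" using z by simp
    also have "\<dots> \<le> \<phi> v x ^ k * \<phi> v z"
      using x by (intro mult_right_mono one_le_power) auto
    also have "\<dots> = \<phi> v (x ^ k * z)"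
      using x z by (simp add: v.val_mult v.val_power v.closed)
    finally have "\<phi> v (x ^ k * z) > 1" .
    moreover have "\<phi> w (x ^ k * z) < 1"
      using True x z power_le_one[of "\<phi> w x" k] mult_left_le_one_le[of "\<phi> w z" "\<phi> w x ^ k"]
      by (simp add: w.val_mult w.val_power w.closed)
    moreover have "\<phi> u (x ^ k * z) < 1" if "u \<in> V" for u
    proof -
      interpret u: nonarch_field F "\<phi> u" by (rule nf) (use that in simp)
      show ?thesis using k that x z by (simp add: u.val_mult u.val_power u.closed)
    qed
    moreover have "x ^ k * z \<in> F" using x z by (simp add: v.closed)
    ultimately show ?thesis by blast
  next
    case False
    \<comment> \<open>In the ultrametric setting the values are exact: \<open>h\<close> has value 1
      at \<open>v\<close> and at \<open>w\<close>, and the value of \<open>x ^ k\<close> at the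
      places of \<open>V\<close>. Thus \<open>h * z\<close> behaves like \<open>z\<close> at
      \<open>v\<close> and \<open>w\<close> and is small on \<open>V\<close>.\<close>
    define h where "h = x ^ k / (1 + x ^ k)"
    have y: "x ^ k \<in> F" "1 + x ^ k \<in> F" "h \<in> F" "h * z \<in> F"
      using x z by (auto simp: h_def v.closed)
    have "\<phi> v (1 + x ^ k) = \<phi> v (x ^ k)"
      by (rule v.val_add_eq) (use x k y in \<open>auto simp: v.val_power v.closed\<close>)
    then have "\<phi> v h = 1"
      unfolding h_def v.val_divide[OF y(1,2)] using x(1,2) by (simp add: v.val_power)
    then have "\<phi> v (h * z) > 1" using z y by (simp add: v.val_mult)
    moreover have "\<phi> w (1 + x ^ k) = \<phi> w (x ^ k)"
      by (rule w.val_add_eq) (use False x k y in \<open>auto simp: w.val_power v.closed\<close>)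
    then have "\<phi> w h = 1"
      unfolding h_def w.val_divide[OF y(1,2)] using False x(1) by (simp add: w.val_power)
    then have "\<phi> w (h * z) < 1" using z y by (simp add: w.val_mult)
    moreover have "\<phi> u (h * z) < 1" if u: "u \<in> V" for u
    proof -
      interpret u: nonarch_field F "\<phi> u" by (rule nf) (use u in simp)
      have "\<phi> u (x ^ k + 1) = \<phi> u 1"
        by (rule u.val_add_eq) (use x k u y in \<open>auto simp: u.val_power power_less_one_iff v.closed\<close>)
      then have "\<phi> u h = \<phi> u x ^ k"
        unfolding h_def u.val_divide[OF y(1,2)] using x(1) by (simp add: u.val_power add.commute)
      then show ?thesis using k u z y by (simp add: u.val_mult)
    qed
    ultimately show ?thesis using y by blast
  qed
qed

subsection \<open>Finiteness of the set of places where an element is not integral\<close>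

text \<open>Stated for a family rather than a set: if two members coincide, their difference is the
  relation, and otherwise a dimension count applies. Powers of a root of unity, for instance, may
  repeat.\<close>

lemma rat_dependent:
  fixes x :: "'i \<Rightarrow> complex"
  assumes "finite B" "finite I" "card B < card I"
    and span: "\<And>i. i \<in> I \<Longrightarrow> \<exists>c :: complex \<Rightarrow> rat. x i = (\<Sum>b\<in>B. of_rat (c b) * b)"
  shows "\<exists>c :: 'i \<Rightarrow> rat. (\<exists>i\<in>I. c i \<noteq> 0) \<and> (\<Sum>i\<in>I. of_rat (c i) * x i) = 0"
proof -
  interpret vs: vector_space "\<lambda>(r::rat) (y::complex). of_rat r * y"
    by unfold_locales (auto simp: algebra_simps of_rat_add of_rat_mult)
  show ?thesis
  proof (cases "inj_on x I")
    case True
    have "x ` I \<subseteq> vs.span B"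
    proof safe
      fix i assume "i \<in> I"
      then obtain c where c: "x i = (\<Sum>b\<in>B. of_rat (c b) * b)" using span by blast
      show "x i \<in> vs.span B"
        unfolding c by (intro vs.span_sum vs.span_scale vs.span_base)
    qed
    moreover have "card (x ` I) = card I" using True by (rule card_image)
    ultimately have "vs.dependent (x ` I)"
      using vs.independent_span_bound[OF assms(1), of "x ` I"] assms(3) by auto
    then obtain u where u: "\<exists>v\<in>x ` I. u v \<noteq> 0" "(\<Sum>v\<in>x ` I. of_rat (u v) * v) = 0"
      using vs.dependent_finite[of "x ` I"] assms(2) by auto
    then show ?thesis
      by (intro exI[of _ "\<lambda>i. u (x i)"]) (auto simp: sum.reindex[OF True])
  next
    case False
    then obtain i j where ij: "i \<in> I" "j \<in> I" "i \<noteq> j" "x i = x j" by (auto simp: inj_on_def)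
    have "(\<Sum>k\<in>I. of_rat (if k = i then 1 else if k = j then - 1 else 0) * x k) =
        (\<Sum>k\<in>I. (if k = i then x k else 0) - (if k = j then x k else 0))"
      by (rule sum.cong) (use ij in auto)
    also have "\<dots> = 0" using ij assms(2) by (simp add: sum_subtractf)
    finally show ?thesis
      using ij by (intro exI[of _ "\<lambda>k. if k = i then 1 else if k = j then - 1 else 0"]) auto
  qed
qed

lemma common_denominator:
  fixes c :: "'i \<Rightarrow> rat"
  assumes "finite I"
  shows "\<exists>N>0. \<forall>i\<in>I. \<exists>k. of_int N * c i = of_int k"
  using assms
proof (induction I rule: finite_induct)
  case (insert i I)
  then obtain N where N: "N > 0" "\<forall>i\<in>I. \<exists>k. of_int N * c i = of_int k" by auto
  obtain m k where mk: "c i = of_int m / of_int k" "k > 0"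
    by (metis Fract_of_int_quotient Rat_cases)
  have "\<exists>l. of_int (k * N) * c j = of_int l" if j: "j \<in> insert i I" for j
  proof (cases "j = i")
    case True
    then show ?thesis using mk by (intro exI[of _ "N * m"]) simp
  next
    case False
    then obtain l where "of_int N * c j = of_int l" using N j by auto
    then show ?thesis by (intro exI[of _ "k * l"]) (simp add: mult.assoc)
  qed
  then show ?case using N mk by (intro exI[of _ "k * N"]) auto
qed (auto intro: exI[of _ 1])

text \<open>Denominators are cleared and the common divisor is removed. The resulting primitive
  relation cannot have all its coefficients divisible by one prime, which is how it is used for the
  places above \<open>p\<close>.\<close>

lemma int_dependent:
  fixes x :: "'i \<Rightarrow> complex"
  assumes "finite B" "finite I" "card B < card I"
    and span: "\<And>i. i \<in> I \<Longrightarrow> \<exists>c :: complex \<Rightarrow> rat. x i = (\<Sum>b\<in>B. of_rat (c b) * b)"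
  shows "\<exists>c :: 'i \<Rightarrow> int. Gcd (c ` I) = 1 \<and> (\<Sum>i\<in>I. of_int (c i) * x i) = 0"
proof -
  obtain c where c: "\<exists>i\<in>I. c i \<noteq> 0" "(\<Sum>i\<in>I. of_rat (c i) * x i) = 0"
    using rat_dependent[of B I x] assms by blast
  obtain N where N: "N > 0" "\<forall>i\<in>I. \<exists>k. of_int N * c i = of_int k"
    using common_denominator[OF assms(2)] by blast
  then obtain d where d: "\<And>i. i \<in> I \<Longrightarrow> of_int N * c i = of_int (d i)" by metis
  define g where "g = Gcd (d ` I)"
  have "\<exists>i\<in>I. d i \<noteq> 0" using c(1) d N(1) by force
  then have g: "g > 0" unfolding g_def by (auto simp: less_le image_subset_iff)
  define e where "e i = d i div g" for i
  have e: "d i = g * e i" if "i \<in> I" for i using that by (simp add: e_def g_def)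
  have "of_int (g) * (\<Sum>i\<in>I. of_int (e i) * x i) = (\<Sum>i\<in>I. of_rat (of_int N * c i) * x i)"
    using e by (simp add: sum_distrib_left d of_rat_mult mult.assoc)
  also have "\<dots> = of_int N * (\<Sum>i\<in>I. of_rat (c i) * x i)"
    by (simp add: sum_distrib_left of_rat_mult mult.assoc)
  finally have "(\<Sum>i\<in>I. of_int (e i) * x i) = 0" using c g by simp
  \<comment> \<open>\<open>g\<close> times the gcd of the \<open>e i\<close> divides every
    \<open>d i\<close>, hence divides \<open>g\<close>; cancelling \<open>g\<close> leaves gcd
    1.\<close>
  moreover have "g * Gcd (e ` I) dvd g"
    by (subst (2) g_def, rule Gcd_greatest) (auto simp: e)
  then have "Gcd (e ` I) dvd 1" using g by (metis dvd_times_left_cancel_iff less_irrefl mult.right_neutral)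
  then have "Gcd (e ` I) = 1" by simp
  ultimately show ?thesis by blast
qed

text \<open>There are at most \<open>card B\<close> such places. With more, elements
  \<open>x v\<close> that are large at \<open>v\<close> and small at the other places satisfy a
  primitive integer relation; evaluated at each \<open>v\<close>, it forces \<open>p\<close> to
  divide \<open>c v\<close>, contradicting primitivity.\<close>

lemma finite_places_over_prime:
  assumes F: "number_field F" and p: "prime (p::nat)"
  shows "finite {v. finite_place F v \<and> of_nat p \<in> val_max_ideal F v}" (is "finite ?P")
proof -
  have sF: "subfield F" using F by (simp add: number_field_def)
  obtain B where B: "finite B" "\<And>x. x \<in> F \<Longrightarrow> \<exists>c :: complex \<Rightarrow> rat. x = (\<Sum>b\<in>B. of_rat (c b) * b)"
    using F by (auto simp: number_field_def)
  obtain \<phi> where \<phi>: "\<And>w. finite_place F w \<Longrightarrow> \<phi> w \<in> w"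
    using place_nonempty unfolding finite_place_def by metis
  have "card V \<le> card B" if V: "V \<subseteq> ?P" "finite V" for V
  proof (rule ccontr)
    assume "\<not> card V \<le> card B"
    then have card: "card B < card V" by simp
    have "\<exists>x\<in>F. \<phi> v x > 1 \<and> (\<forall>w\<in>V - {v}. \<phi> w x < 1)" if "v \<in> V" for v
      by (rule place_separated_from_finite_set[OF sF]) (use V that \<phi> in auto)
    then obtain x where x: "\<And>v. v \<in> V \<Longrightarrow> x v \<in> F" "\<And>v. v \<in> V \<Longrightarrow> \<phi> v (x v) > 1"
      "\<And>v w. v \<in> V \<Longrightarrow> w \<in> V \<Longrightarrow> w \<noteq> v \<Longrightarrow> \<phi> w (x v) < 1" by (metis Diff_iff singletonD)
    obtain c :: "_ \<Rightarrow> int" where c: "Gcd (c ` V) = 1" "(\<Sum>v\<in>V. of_int (c v) * x v) = 0"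
      using int_dependent[OF B(1) V(2) card, of x] B(2) x(1) by blast
    have "int p dvd c v" if v: "v \<in> V" for v
    proof -
      have fv: "finite_place F v" and pv: "of_nat p \<in> val_max_ideal F v" using v V by auto
      interpret nonarch_field F "\<phi> v" by (rule finite_place_nonarch_field[OF sF fv \<phi>[OF fv]])
      \<comment> \<open>The relation expresses the \<open>v\<close> term by the remaining ones, all
        of value below 1 at \<open>v\<close>. Since \<open>x v\<close> itself has value above 1, the
        coefficient \<open>c v\<close> must have value below 1.\<close>
      have "\<phi> v (\<Sum>w\<in>V - {v}. of_int (c w) * x w) < 1"
      proof (rule val_sum_less)
        fix w assume w: "w \<in> V - {v}"
        then show "of_int (c w) * x w \<in> F" using x closed by simp
        have "\<phi> v (x w) < 1" using x w v by auto
        then show "\<phi> v (of_int (c w) * x w) < 1"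
          using val_of_int[of "c w"] mult_left_le_one_le[of "\<phi> v (x w)" "\<phi> v (of_int (c w))"] x(1)[of w] w
          by (simp add: val_mult closed)
      qed simp
      moreover have "of_int (c v) * x v = - (\<Sum>w\<in>V - {v}. of_int (c w) * x w)"
        using c(2) sum.remove[OF V(2) v, of "\<lambda>w. of_int (c w) * x w"] by (simp add: eq_neg_iff_add_eq_0)
      moreover have "(\<Sum>w\<in>V - {v}. of_int (c w) * x w) \<in> F"
        using x(1) by (auto intro!: closed)
      ultimately have "\<phi> v (of_int (c v) * x v) < 1" by simp
      then have "\<phi> v (of_int (c v)) * \<phi> v (x v) < 1" using x v by (simp add: val_mult closed)
      then have "\<phi> v (of_int (c v)) < 1"
        using x(2)[OF v] by (smt (verit) mult_less_cancel_left2 val_nonneg mult_mono)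
      moreover have "\<phi> v (of_nat p) < 1"
        using finite_place_val_ring_iff(2)[OF sF fv \<phi>[OF fv]] pv closed by simp
      ultimately show ?thesis using prime_dvd_if_val_less_1 p by blast
    qed
    then have "int p dvd Gcd (c ` V)" by (intro Gcd_greatest) auto
    then show False using c p by auto
  qed
  then show ?thesis using finite_if_finite_subsets_card_bdd[of ?P "card B"] by blast
qed

text \<open>\<open>t\<close> is a root of a nonzero integer polynomial. Where \<open>t\<close> has
  value above 1, its leading term would dominate all others if the leading coefficient had value 1;
  so the place lies above one of the finitely many primes dividing that coefficient.\<close>

lemma finite_nonintegral_places:
  assumes F: "number_field F" and t: "t \<in> F"
  shows "finite {v. finite_place F v \<and> t \<notin> val_ring F v}"
proof -
  have sF: "subfield F" using F by (simp add: number_field_def)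
  obtain B where B: "finite B" "\<And>x. x \<in> F \<Longrightarrow> \<exists>c :: complex \<Rightarrow> rat. x = (\<Sum>b\<in>B. of_rat (c b) * b)"
    using F by (auto simp: number_field_def)
  \<comment> \<open>The exponents 0 to \<open>card B\<close> give one power more than the spanning
    set has elements.\<close>
  obtain c :: "nat \<Rightarrow> int" where c: "Gcd (c ` {..card B}) = 1" "(\<Sum>i\<le>card B. of_int (c i) * t ^ i) = 0"
    using int_dependent[OF B(1), of "{..card B}" "\<lambda>i. t ^ i"] B(2) subfield_power[OF sF t] by auto
  \<comment> \<open>The true degree of the relation, since the top coefficients may vanish.\<close>
  define d where "d = Max {i. i \<le> card B \<and> c i \<noteq> 0}"
  have "{i. i \<le> card B \<and> c i \<noteq> 0} \<noteq> {}"
  proof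
    assume "{i. i \<le> card B \<and> c i \<noteq> 0} = {}"
    then have "c ` {..card B} \<subseteq> {0}" by auto
    then show False using c(1) by (simp add: Gcd_0_iff[symmetric])
  qed
  then have "d \<in> {i. i \<le> card B \<and> c i \<noteq> 0}" unfolding d_def by (intro Max_in) auto
  then have d: "d \<le> card B" "c d \<noteq> 0" by auto
  have dmax: "c i = 0" if "i \<le> card B" "i > d" for i
    using that Max_ge[of "{i. i \<le> card B \<and> c i \<noteq> 0}" i] unfolding d_def[symmetric] by auto
  have "(\<Sum>i\<le>d. of_int (c i) * t ^ i) = (\<Sum>i\<le>card B. of_int (c i) * t ^ i)"
    by (rule sum.mono_neutral_left) (use d dmax in auto)
  then have rel: "of_int (c d) * t ^ d = - (\<Sum>i<d. of_int (c i) * t ^ i)"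
    using c(2) by (simp add: lessThan_Suc_atMost[symmetric] eq_neg_iff_add_eq_0 add.commute)
  have "{v. finite_place F v \<and> t \<notin> val_ring F v} \<subseteq>
     (\<Union>p\<in>{p. prime p \<and> p dvd nat \<bar>c d\<bar>}. {v. finite_place F v \<and> of_nat p \<in> val_max_ideal F v})"
  proof safe
    fix v assume v: "finite_place F v" "t \<notin> val_ring F v"
    obtain \<phi> where \<phi>: "\<phi> \<in> v" using place_nonempty[of F v] v(1) by (auto simp: finite_place_def)
    interpret nonarch_field F \<phi> by (rule finite_place_nonarch_field[OF sF v(1) \<phi>])
    have t1: "\<phi> t > 1" using finite_place_val_ring_iff(1)[OF sF v(1) \<phi> t] v(2) by simp
    have "\<phi> (of_int (c d)) < 1"
    proof (rule ccontr)
      assume "\<not> \<phi> (of_int (c d)) < 1"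
      then have "\<phi> (of_int (c d)) = 1" using val_of_int[of "c d"] by simp
      then have eq: "\<phi> (of_int (c d) * t ^ d) = \<phi> t ^ d" using t by (simp add: val_mult val_power closed)
      have "\<phi> (\<Sum>i<d. of_int (c i) * t ^ i) < \<phi> t ^ d"
      proof (rule val_sum_less)
        fix i assume i: "i \<in> {..<d}"
        show "of_int (c i) * t ^ i \<in> F" using t closed by simp
        have "\<phi> (of_int (c i)) * \<phi> t ^ i \<le> \<phi> t ^ i"
          using val_of_int[of "c i"] by (intro mult_left_le_one_le) auto
        also have "\<dots> < \<phi> t ^ d" using t1 i by (intro power_strict_increasing) auto
        finally show "\<phi> (of_int (c i) * t ^ i) < \<phi> t ^ d" using t by (simp add: val_mult val_power closed)
      qed (use t1 in simp)
      moreover have "(\<Sum>i<d. of_int (c i) * t ^ i) \<in> F" using t by (auto intro!: closed)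
      ultimately show False using eq unfolding rel by simp
    qed
    then have "\<phi> (of_nat (nat \<bar>c d\<bar>)) < 1" by (simp only: val_of_int_eq)
    then obtain p where "prime p" "p dvd nat \<bar>c d\<bar>" "\<phi> (of_nat p) < 1"
      using ex_prime_val_less_1[of "nat \<bar>c d\<bar>"] d by auto
    then show "v \<in> (\<Union>p\<in>{p. prime p \<and> p dvd nat \<bar>c d\<bar>}. {v. finite_place F v \<and> of_nat p \<in> val_max_ideal F v})"
      using v finite_place_val_ring_iff(2)[OF sF v(1) \<phi>] by (auto simp: closed)
  qed
  moreover have "finite {p. prime p \<and> p dvd nat \<bar>c d\<bar>}"
    using d by (intro finite_subset[OF _ finite_divisors_nat[of "nat \<bar>c d\<bar>"]]) auto
  ultimately show ?thesis
    using finite_places_over_prime[OF F] by (auto intro: finite_subset)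
qed

subsection \<open>Linear and quadratic forms\<close>

lemma lin_form_cong: "(\<And>j. j \<le> n \<Longrightarrow> x j = y j) \<Longrightarrow> lin_form n a x = lin_form n a y"
  by (simp add: lin_form_def)

lemma lin_form_add: "lin_form n a (\<lambda>j. x j + y j) = lin_form n a x + lin_form n a y"
  by (simp add: lin_form_def algebra_simps sum.distrib)

lemma lin_form_diff: "lin_form n a (\<lambda>j. x j - y j) = lin_form n a x - lin_form n a y"
  by (simp add: lin_form_def algebra_simps sum_subtractf)

lemma lin_form_scale: "lin_form n a (\<lambda>j. c * x j) = c * lin_form n a x"
  by (simp add: lin_form_def sum_distrib_left mult.left_commute)

lemma lin_form_divide: "lin_form n a (\<lambda>j. x j / c) = lin_form n a x / c"
  by (simp add: lin_form_def sum_divide_distrib)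

lemma lin_form_sum: "lin_form n a (\<lambda>j. \<Sum>i\<in>I. x i j) = (\<Sum>i\<in>I. lin_form n a (x i))"
  unfolding lin_form_def sum_distrib_left by (rule sum.swap)

lemma lin_form_unit: "k \<le> n \<Longrightarrow> lin_form n a (\<lambda>j. if j = k then 1 else 0) = a k"
  by (simp add: lin_form_def if_distrib[of "\<lambda>t. a _ * t"] cong: if_cong)

lemmas lin_form_simps = lin_form_add lin_form_diff lin_form_scale lin_form_divide lin_form_sum

text \<open>The symmetric bilinear form polar to the quadric; the matrix \<open>B\<close> itself may
  be nonsymmetric. Written as the gradient at \<open>y\<close> applied to \<open>x\<close>, it
  inherits linearity in \<open>x\<close> from \<open>lin_form\<close>.\<close>

definition polar_form :: "nat \<Rightarrow> (nat \<Rightarrow> nat \<Rightarrow> complex) \<Rightarrow> (nat \<Rightarrow> complex) \<Rightarrow> (nat \<Rightarrow> complex) \<Rightarrow> complex" where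
  "polar_form n B y x = lin_form n (\<lambda>i. quad_partial n B i y) x"

lemmas polar_form_simps = lin_form_simps[of n "\<lambda>i. quad_partial n B i y" for n B y, folded polar_form_def]

lemma polar_form_eq:
  "polar_form n B y x = (\<Sum>i\<le>n. \<Sum>j\<le>n. B i j * (x i * y j)) + (\<Sum>i\<le>n. \<Sum>j\<le>n. B i j * (y i * x j))"
proof -
  have "polar_form n B y x = (\<Sum>i\<le>n. \<Sum>j\<le>n. B i j * (x i * y j)) + (\<Sum>i\<le>n. \<Sum>j\<le>n. B j i * (x i * y j))"
    unfolding polar_form_def lin_form_def quad_partial_def
    by (simp add: sum_distrib_left sum.distrib[symmetric] algebra_simps)
  also have "(\<Sum>i\<le>n. \<Sum>j\<le>n. B j i * (x i * y j)) = (\<Sum>i\<le>n. \<Sum>j\<le>n. B i j * (y i * x j))"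
    by (subst sum.swap) (simp add: mult_ac)
  finally show ?thesis .
qed

lemma polar_form_commute: "polar_form n B x y = polar_form n B y x"
  by (simp add: polar_form_eq add.commute)

lemma polar_form_self: "polar_form n B x x = 2 * quad_form n B x"
  by (simp add: polar_form_eq quad_form_def mult.assoc)

lemma quad_form_cong: "(\<And>j. j \<le> n \<Longrightarrow> x j = y j) \<Longrightarrow> quad_form n B x = quad_form n B y"
  by (simp add: quad_form_def)

lemma quad_form_add:
  "quad_form n B (\<lambda>j. x j + y j) = quad_form n B x + quad_form n B y + polar_form n B y x"
  by (simp add: polar_form_eq quad_form_def algebra_simps sum.distrib)

lemma quad_form_scale: "quad_form n B (\<lambda>j. c * x j) = c\<^sup>2 * quad_form n B x"
  by (simp add: quad_form_def sum_distrib_left power2_eq_square mult_ac)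

lemma polar_form_cong: "(\<And>j. j \<le> n \<Longrightarrow> x j = x' j) \<Longrightarrow> polar_form n B y x = polar_form n B y x'"
  by (simp add: polar_form_def cong: lin_form_cong)

lemma subfield_lin_form:
  assumes "subfield F" "\<And>j. j \<le> n \<Longrightarrow> a j \<in> F" "\<And>j. j \<le> n \<Longrightarrow> x j \<in> F"
  shows "lin_form n a x \<in> F"
  unfolding lin_form_def using assms by (auto intro!: subfield_sum subfield_mult)

lemma subfield_polar_form:
  assumes "subfield F" "\<And>i j. i \<le> n \<Longrightarrow> j \<le> n \<Longrightarrow> B i j \<in> F" "\<And>j. j \<le> n \<Longrightarrow> x j \<in> F" "\<And>j. j \<le> n \<Longrightarrow> y j \<in> F"
  shows "polar_form n B y x \<in> F"
  unfolding polar_form_def quad_partial_def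
  using assms by (auto intro!: subfield_lin_form subfield_sum subfield_mult subfield_add)

text \<open>Gram-Schmidt for linear forms, adding one form at a time: by independence the new form
  stays nonzero after subtracting its part along the earlier ones, and all divisions take place in
  \<open>F\<close>.\<close>

lemma dual_vectors_exist:
  assumes F: "subfield F" and a: "\<And>i j. i \<in> {1..m} \<Longrightarrow> j \<le> n \<Longrightarrow> a i j \<in> F"
    and gp: "general_position n m a"
  shows "\<exists>e. (\<forall>i\<in>{1..m}. \<forall>j\<le>n. e i j \<in> F) \<and>
     (\<forall>i\<in>{1..m}. \<forall>k\<in>{1..m}. lin_form n (a i) (e k) = (if i = k then 1 else 0))"
  using a gp
proof (induction m)
  case (Suc m)
  let ?M = "Suc m"
  have split: "{1..?M} = insert ?M {1..m}" by auto
  have "general_position n m a"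
    unfolding general_position_def
  proof (intro allI impI ballI)
    fix c i assume c: "\<forall>j\<le>n. (\<Sum>i\<in>{1..m}. c i * a i j) = 0" and i: "i \<in> {1..m}"
    have "(\<Sum>i\<in>{1..?M}. (c(?M := 0)) i * a i j) = (\<Sum>i\<in>{1..m}. c i * a i j)" for j
      unfolding split by (subst sum.insert) (auto intro!: sum.cong)
    then have "(c(?M := 0)) i = 0"
      using Suc.prems(2) c i unfolding general_position_def by (metis atLeastAtMost_iff le_SucI)
    then show "c i = 0" using i by auto
  qed
  then obtain e where "\<forall>i\<in>{1..m}. \<forall>j\<le>n. e i j \<in> F"
    "\<forall>i\<in>{1..m}. \<forall>k\<in>{1..m}. lin_form n (a i) (e k) = (if i = k then 1 else 0)"
    using Suc.IH Suc.prems(1) by auto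
  then have e: "\<And>i j. i \<in> {1..m} \<Longrightarrow> j \<le> n \<Longrightarrow> e i j \<in> F"
    "\<And>i k. i \<in> {1..m} \<Longrightarrow> k \<in> {1..m} \<Longrightarrow> lin_form n (a i) (e k) = (if i = k then 1 else 0)"
    by blast+
  define l where "l i = lin_form n (a ?M) (e i)" for i
  \<comment> \<open>The new form minus the combination of earlier forms that agrees with it on
    \<open>e 1\<close> to \<open>e m\<close>.\<close>
  define b where "b j = a ?M j - (\<Sum>i\<in>{1..m}. l i * a i j)" for j
  have "\<exists>j0\<le>n. b j0 \<noteq> 0"
  proof (rule ccontr)
    assume "\<not> (\<exists>j0\<le>n. b j0 \<noteq> 0)"
    then have b0: "b j = 0" if "j \<le> n" for j using that by auto
    have "(\<Sum>i\<in>{1..?M}. (if i = ?M then 1 else - l i) * a i j) = 0" if "j \<le> n" for j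
    proof -
      have "(\<Sum>i\<in>{1..?M}. (if i = ?M then 1 else - l i) * a i j) = a ?M j + (\<Sum>i\<in>{1..m}. - l i * a i j)"
        unfolding split by (subst sum.insert) (auto intro!: sum.cong)
      then show ?thesis using b0[OF that] by (simp add: b_def sum_negf)
    qed
    then have "\<forall>i\<in>{1..?M}. (if i = ?M then 1 else - l i) = 0"
      using spec[OF Suc.prems(2)[unfolded general_position_def], of "\<lambda>i. if i = ?M then 1 else - l i"] by blast
    then show False by (auto dest: bspec[of _ _ ?M])
  qed
  then obtain j0 where j0: "j0 \<le> n" "b j0 \<noteq> 0" by auto
  \<comment> \<open>The unit vector at \<open>j0\<close> without its components along the
    \<open>e i\<close>. Before the division the earlier forms vanish on it and the new form takes
    the value \<open>b j0\<close>.\<close>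
  define d where "d j = ((if j = j0 then 1 else 0) - (\<Sum>i\<in>{1..m}. a i j0 * e i j)) / b j0" for j
  have lF: "l i \<in> F" if "i \<in> {1..m}" for i
    unfolding l_def using F Suc.prems(1) e(1) that by (intro subfield_lin_form) auto
  have "b j0 \<in> F"
    unfolding b_def using F Suc.prems(1) j0 lF
    by (intro subfield_diff subfield_sum subfield_mult) auto
  then have dF: "d j \<in> F" if "j \<le> n" for j
    unfolding d_def using F Suc.prems(1) j0 e(1) that
    by (intro subfield_divide subfield_diff subfield_sum subfield_mult)
      (auto intro: subfield_zero subfield_one)
  have ld: "lin_form n (a k) d = (a k j0 - (\<Sum>i\<in>{1..m}. a i j0 * lin_form n (a k) (e i))) / b j0" for k
    unfolding d_def by (simp add: lin_form_simps lin_form_unit j0)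
  have ld0: "lin_form n (a k) d = 0" if "k \<in> {1..m}" for k
  proof -
    have "(\<Sum>i\<in>{1..m}. a i j0 * lin_form n (a k) (e i)) = (\<Sum>i\<in>{1..m}. if k = i then a i j0 else 0)"
      by (rule sum.cong) (use e(2) that in auto)
    then show ?thesis using that unfolding ld by simp
  qed
  have ld1: "lin_form n (a ?M) d = 1"
    unfolding ld l_def[symmetric] using j0 by (simp add: b_def mult.commute)
  \<comment> \<open>Subtracting \<open>l i * d j\<close> makes the new form vanish on the earlier
    vectors without changing their values under the earlier forms.\<close>
  define e' where "e' i = (if i = ?M then d else (\<lambda>j. e i j - l i * d j))" for i
  show ?case
  proof (intro exI[of _ e'] conjI ballI allI impI)
    fix i j assume i: "i \<in> {1..?M}" and j: "j \<le> n"
    show "e' i j \<in> F"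
    proof (cases "i = ?M")
      case False
      then have "i \<in> {1..m}" using i by auto
      then show ?thesis using False F e(1) j lF dF by (auto simp: e'_def intro!: subfield_diff subfield_mult)
    qed (use dF j in \<open>simp add: e'_def\<close>)
  next
    fix i k assume ik: "i \<in> {1..?M}" "k \<in> {1..?M}"
    then have "i = ?M \<or> i \<in> {1..m}" "k = ?M \<or> k \<in> {1..m}" by auto
    then show "lin_form n (a i) (e' k) = (if i = k then 1 else 0)"
      using ld0 ld1 e(2) by (auto simp: e'_def lin_form_simps l_def)
  qed
qed auto

text \<open>In these coordinates the quadric is \<open>q(x) + c u w = 0\<close>. That the coordinates are complete
  follows from the hypothesis on \<open>L \<inter> Q\<close>: a vector of \<open>L\<close> polar to both points could be
  combined with them to a third point of \<open>L \<inter> Q\<close>.\<close>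
lemma adapted_coordinates:
  fixes K :: "complex set" and n :: nat and a B :: "nat \<Rightarrow> nat \<Rightarrow> complex" and p1 p2 :: "nat \<Rightarrow> complex"
  defines "I \<equiv> {1..n-1}"
  assumes K: "subfield K"
    and a: "\<forall>i\<in>I. \<forall>j\<le>n. a i j \<in> K" and gp: "general_position n (n - 1) a"
    and B: "\<forall>i\<le>n. \<forall>j\<le>n. B i j \<in> K"
    and p1: "proj_point K n p1" "p1 \<in> line_quadric_pts n a B"
    and p2: "proj_point K n p2" "p2 \<in> line_quadric_pts n a B"
    and distinct: "\<not> proj_eq n p1 p2"
    and only: "\<forall>x\<in>line_quadric_pts n a B. proj_eq n p1 x \<or> proj_eq n p2 x"
  shows "\<exists>e c. c \<in> K \<and> c \<noteq> 0 \<and> (\<forall>i\<in>I. \<forall>j\<le>n. e i j \<in> K) \<and>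
    (\<forall>i\<in>I. \<forall>k\<in>I. lin_form n (a i) (e k) = (if i = k then 1 else 0)) \<and>
    (\<forall>x u w. quad_form n B (\<lambda>j. (\<Sum>i\<in>I. x i * e i j) + u * p1 j + w * p2 j) =
       quad_form n B (\<lambda>j. \<Sum>i\<in>I. x i * e i j) + c * u * w) \<and>
    (\<forall>Y. \<exists>x u w. \<forall>j\<le>n. Y j = (\<Sum>i\<in>I. x i * e i j) + u * p1 j + w * p2 j)"
proof -
  have L: "\<And>i. i \<in> I \<Longrightarrow> lin_form n (a i) p1 = 0" "\<And>i. i \<in> I \<Longrightarrow> lin_form n (a i) p2 = 0"
    and Q: "quad_form n B p1 = 0" "quad_form n B p2 = 0"
    using p1(2) p2(2) by (auto simp: line_quadric_pts_def I_def)
  have pK: "\<And>j. j \<le> n \<Longrightarrow> p1 j \<in> K" "\<And>j. j \<le> n \<Longrightarrow> p2 j \<in> K"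
    using p1(1) p2(1) by (auto simp: proj_point_def)
  \<comment> \<open>Turns proportionality to \<open>p1\<close> or \<open>p2\<close> into a statement
    about polar values, in which the contradictions below are found.\<close>
  have proj_eq_polar: "\<exists>t\<noteq>0. \<forall>y. polar_form n B y x = t * polar_form n B y p" if "proj_eq n p x" for p x
  proof -
    obtain t where "t \<noteq> 0" "\<forall>i\<le>n. x i = t * p i" using \<open>proj_eq n p x\<close> by (auto simp: proj_eq_def)
    then have "polar_form n B y x = t * polar_form n B y p" for y
      using polar_form_cong[of n x "\<lambda>i. t * p i" B y] by (simp add: polar_form_simps)
    then show ?thesis using \<open>t \<noteq> 0\<close> by blast
  qed
  have self: "polar_form n B p1 p1 = 0" "polar_form n B p2 p2 = 0"
    using Q by (auto simp: polar_form_self)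
  define c where "c = polar_form n B p1 p2"
  have c': "polar_form n B p2 p1 = c" unfolding c_def by (rule polar_form_commute)
  have cK: "c \<in> K" unfolding c_def by (rule subfield_polar_form) (use K B pK in auto)
  \<comment> \<open>If \<open>c\<close> were 0, then \<open>p1 + p2\<close> would be a third point
    of the intersection of the line with the quadric.\<close>
  have c0: "c \<noteq> 0"
  proof
    assume "c = 0"
    let ?s = "\<lambda>j. p1 j + p2 j"
    have nz: "proj_point UNIV n ?s"
    proof (rule ccontr)
      assume "\<not> ?thesis"
      then have "\<forall>i\<le>n. p2 i = - 1 * p1 i" by (auto simp: proj_point_def add_eq_0_iff)
      then show False using distinct unfolding proj_eq_def by (metis neg_equal_0_iff_equal zero_neq_one)
    qed
    have "quad_form n B ?s = 0" using Q \<open>c = 0\<close> c' by (simp add: quad_form_add)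
    then have "?s \<in> line_quadric_pts n a B"
      using nz L by (simp add: line_quadric_pts_def I_def lin_form_simps)
    then consider t where "t \<noteq> 0" "\<forall>i\<le>n. p1 i + p2 i = t * p1 i" | t where "t \<noteq> 0" "\<forall>i\<le>n. p1 i + p2 i = t * p2 i"
      using only by (auto simp: proj_eq_def)
    then show False
    proof cases
      case 1
      then have eq: "p2 i = (t - 1) * p1 i" if "i \<le> n" for i using that by (metis add_diff_cancel_left' left_diff_distrib' mult_1)
      then have "t - 1 \<noteq> 0" using p2(1) by (auto simp: proj_point_def)
      then show False using eq distinct unfolding proj_eq_def by blast
    next
      case 2
      then have eq: "p1 i = (t - 1) * p2 i" if "i \<le> n" for i using that by (metis add_diff_cancel_right' left_diff_distrib' mult_1)
      then have "t - 1 \<noteq> 0" using p1(1) by (auto simp: proj_point_def)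
      then have "\<forall>i\<le>n. p2 i = inverse (t - 1) * p1 i" "inverse (t - 1) \<noteq> 0" using eq by (auto simp: field_simps)
      then show False using distinct unfolding proj_eq_def by blast
    qed
  qed
  obtain e0 where e0: "\<And>i j. i \<in> I \<Longrightarrow> j \<le> n \<Longrightarrow> e0 i j \<in> K"
    "\<And>i k. i \<in> I \<Longrightarrow> k \<in> I \<Longrightarrow> lin_form n (a i) (e0 k) = (if i = k then 1 else 0)"
    using dual_vectors_exist[OF K _ gp] a unfolding I_def by blast
  \<comment> \<open>\<open>U\<close> and \<open>W\<close> are the coordinates along
    \<open>p1\<close> and \<open>p2\<close>: both points are isotropic and pair to \<open>c\<close>,
    so \<open>U\<close> is read off with \<open>p2\<close> and \<open>W\<close> with
    \<open>p1\<close>.\<close>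
  define U where "U x = polar_form n B p2 x / c" for x
  define W where "W x = polar_form n B p1 x / c" for x
  \<comment> \<open>Makes the dual vectors polar to both points, which removes all mixed terms from
    the quadric. Duality survives because the linear forms vanish on \<open>p1\<close> and
    \<open>p2\<close>.\<close>
  define e where "e i = (\<lambda>j. e0 i j - U (e0 i) * p1 j - W (e0 i) * p2 j)" for i
  have eK: "e i j \<in> K" if "i \<in> I" "j \<le> n" for i j
    unfolding e_def U_def W_def using K e0(1) that pK cK B
    by (intro subfield_diff subfield_mult subfield_divide subfield_polar_form) auto
  have ed: "lin_form n (a i) (e k) = (if i = k then 1 else 0)" if "i \<in> I" "k \<in> I" for i k
    unfolding e_def by (simp add: lin_form_simps e0(2) that L)
  have pe: "polar_form n B p1 (e i) = 0" "polar_form n B p2 (e i) = 0" for i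
    unfolding e_def by (simp_all add: polar_form_simps self c' c_def[symmetric] U_def W_def c0)
  have quad: "quad_form n B (\<lambda>j. (\<Sum>i\<in>I. x i * e i j) + u * p1 j + w * p2 j) =
           quad_form n B (\<lambda>j. \<Sum>i\<in>I. x i * e i j) + c * u * w" for x u w
  proof -
    have pu: "polar_form n B (\<lambda>j. t * p j) y = t * polar_form n B p y" for t p y
      by (simp add: polar_form_commute[of n B _ y] polar_form_simps)
    show ?thesis
      by (simp add: quad_form_add quad_form_scale Q pu polar_form_simps pe c')
  qed
  have "\<exists>x u w. \<forall>j\<le>n. Y j = (\<Sum>i\<in>I. x i * e i j) + u * p1 j + w * p2 j" for Y
  proof -
    \<comment> \<open>First the components along the \<open>e i\<close> are removed, then those
      along \<open>p1\<close> and \<open>p2\<close>. The remainder \<open>Y2\<close> satisfies all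
      hyperplane equations and is polar to both points; it has to be zero.\<close>
    define Y1 where "Y1 = (\<lambda>j. Y j - (\<Sum>i\<in>I. lin_form n (a i) Y * e i j))"
    define Y2 where "Y2 = (\<lambda>j. Y1 j - U Y1 * p1 j - W Y1 * p2 j)"
    have Y1L: "lin_form n (a k) Y1 = 0" if "k \<in> I" for k
    proof -
      have "(\<Sum>i\<in>I. lin_form n (a i) Y * lin_form n (a k) (e i)) = (\<Sum>i\<in>I. if k = i then lin_form n (a i) Y else 0)"
        by (rule sum.cong) (use ed that in auto)
      then show ?thesis using that by (simp add: Y1_def lin_form_simps I_def)
    qed
    then have Y2L: "lin_form n (a k) Y2 = 0" if "k \<in> I" for k
      using that L by (simp add: Y2_def lin_form_simps)
    have pY: "polar_form n B p1 Y2 = 0" "polar_form n B p2 Y2 = 0"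
      by (simp_all add: Y2_def polar_form_simps self c' c_def[symmetric] U_def W_def c0)
    have "Y2 j = 0" if "j \<le> n" for j
    proof (rule ccontr)
      assume "Y2 j \<noteq> 0"
      then have nz: "proj_point UNIV n Y2" using that by (auto simp: proj_point_def)
      show False
      proof (cases "quad_form n B Y2 = 0")
        case True
        then have "Y2 \<in> line_quadric_pts n a B" using nz Y2L by (simp add: line_quadric_pts_def I_def)
        then obtain t where "t \<noteq> 0" "(\<forall>y. polar_form n B y Y2 = t * polar_form n B y p1) \<or>
             (\<forall>y. polar_form n B y Y2 = t * polar_form n B y p2)"
          using only proj_eq_polar by metis
        then show False using pY c0 c' c_def by (metis mult_eq_0_iff)
      next
        case False
        \<comment> \<open>Chosen so that the quadratic form at \<open>Y2 + p1 + r * p2\<close>,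
          which equals its value at \<open>Y2\<close> plus \<open>c * r\<close>, vanishes.\<close>
        define r where "r = - quad_form n B Y2 / c"
        have r: "r \<noteq> 0" "c * r = - quad_form n B Y2" using False c0 by (auto simp: r_def)
        define Z where "Z = (\<lambda>j. Y2 j + 1 * p1 j + r * p2 j)"
        have pZ: "polar_form n B p2 Z = c" "polar_form n B p1 Z = c * r"
          by (simp_all add: Z_def polar_form_simps self c' c_def[symmetric] pY mult.commute del: mult_1)
        have "proj_point UNIV n Z"
        proof (rule ccontr)
          assume "\<not> ?thesis"
          then have "polar_form n B p2 Z = polar_form n B p2 (\<lambda>j. 0 * p1 j)"
            by (intro polar_form_cong) (auto simp: proj_point_def)
          then show False using pZ c0 by (simp add: polar_form_simps del: mult_zero_left)
        qed
        moreover have "quad_form n B Z = 0"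
        proof -
          have pu: "polar_form n B (\<lambda>j. t * p j) y = t * polar_form n B p y" for t p y
            by (simp add: polar_form_commute[of n B _ y] polar_form_simps)
          show ?thesis unfolding Z_def
            using r(2) by (simp add: quad_form_add quad_form_scale Q pu polar_form_simps pY c' mult.commute del: mult_1)
        qed
        ultimately have "Z \<in> line_quadric_pts n a B"
          using Y2L L by (simp add: line_quadric_pts_def I_def Z_def lin_form_simps del: mult_1)
        \<comment> \<open>A multiple of \<open>p1\<close> would have polar value 0 with
          \<open>p1\<close>, and a multiple of \<open>p2\<close> polar value 0 with
          \<open>p2\<close>; for \<open>Z\<close> these values are \<open>c * r\<close> and
          \<open>c\<close>.\<close>
        then obtain t where "t \<noteq> 0" "(\<forall>y. polar_form n B y Z = t * polar_form n B y p1) \<or>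
             (\<forall>y. polar_form n B y Z = t * polar_form n B y p2)"
          using only proj_eq_polar by metis
        then show False using pZ self c0 r(1) by (metis mult_eq_0_iff)
      qed
    qed
    then have "\<forall>j\<le>n. Y j = (\<Sum>i\<in>I. lin_form n (a i) Y * e i j) + U Y1 * p1 j + W Y1 * p2 j"
      by (simp add: Y2_def Y1_def algebra_simps)
    then show ?thesis
      by (intro exI[of _ "\<lambda>i. lin_form n (a i) Y"] exI[of _ "U Y1"] exI[of _ "W Y1"])
  qed
  then show ?thesis
    by (intro exI[of _ e] exI[of _ c] conjI ballI allI impI cK c0 eK ed quad)
qed

subsection \<open>Integral points\<close>

lemma val_ring_closed:
  assumes "subfield F" "finite_place F v"
  shows "0 \<in> val_ring F v" "1 \<in> val_ring F v"
    "\<And>x y. x \<in> val_ring F v \<Longrightarrow> y \<in> val_ring F v \<Longrightarrow> x + y \<in> val_ring F v"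
    "\<And>x y. x \<in> val_ring F v \<Longrightarrow> y \<in> val_ring F v \<Longrightarrow> x - y \<in> val_ring F v"
    "\<And>x y. x \<in> val_ring F v \<Longrightarrow> y \<in> val_ring F v \<Longrightarrow> x * y \<in> val_ring F v"
    "\<And>x k. x \<in> val_ring F v \<Longrightarrow> x ^ k \<in> val_ring F v"
proof -
  obtain \<phi> where \<phi>: "\<phi> \<in> v" using place_nonempty[of F v] assms by (auto simp: finite_place_def)
  interpret nonarch_field F \<phi> by (rule finite_place_nonarch_field[OF assms \<phi>])
  have R: "x \<in> val_ring F v \<longleftrightarrow> x \<in> F \<and> \<phi> x \<le> 1" for x
    using finite_place_val_ring_iff(1)[OF assms \<phi>, of x] by (auto simp: val_ring_def)
  show "0 \<in> val_ring F v" "1 \<in> val_ring F v" using closed by (auto simp: R)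
  show "x + y \<in> val_ring F v" if "x \<in> val_ring F v" "y \<in> val_ring F v" for x y
    using that val_add[of x y] closed by (auto simp: R)
  then show "x - y \<in> val_ring F v" if "x \<in> val_ring F v" "y \<in> val_ring F v" for x y
    using that[unfolded R] closed \<open>\<And>x y. x \<in> val_ring F v \<Longrightarrow> y \<in> val_ring F v \<Longrightarrow> x + y \<in> val_ring F v\<close>[of x "- y"]
    by (auto simp: R)
  show "x * y \<in> val_ring F v" if "x \<in> val_ring F v" "y \<in> val_ring F v" for x y
    using that closed by (auto simp: R val_mult mult_le_one)
  show "x ^ k \<in> val_ring F v" if "x \<in> val_ring F v" for x k
    using that closed by (auto simp: R val_power power_le_one)
qed

text \<open>An admissible coordinate vector is \<open>c\<close> times \<open>X\<close>. The unit
  value of a linear form at \<open>X\<close> gives \<open>c\<close> value at most 1, and primitivity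
  of the vector gives at least 1. So the product of the equations, which lies in the vanishing
  ideal, takes a unit value there.\<close>

lemma not_reduces_to_divisor:
  assumes F: "subfield F" and v: "finite_place F v" "\<phi> \<in> v" and n: "n \<ge> 2"
    and a: "\<And>i j. i \<in> {1..n-1} \<Longrightarrow> j \<le> n \<Longrightarrow> a i j \<in> val_ring F v"
    and B: "\<And>i j. i \<le> n \<Longrightarrow> j \<le> n \<Longrightarrow> B i j \<in> val_ring F v"
    and X: "\<And>j. j \<le> n \<Longrightarrow> X j \<in> val_ring F v"
    and lin: "\<And>i. i \<in> {1..n-1} \<Longrightarrow> lin_form n (a i) X \<in> F \<and> \<phi> (lin_form n (a i) X) = 1"
    and quad: "quad_form n B X \<in> F \<and> \<phi> (quad_form n B X) = 1"
  shows "\<not> reduces_to F v n (divisor_pts n a B) X"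
proof
  interpret nonarch_field F \<phi> by (rule finite_place_nonarch_field[OF F v])
  note R = val_ring_closed[OF F v(1)]
  note R_iff = finite_place_val_ring_iff(1)[OF F v] and m_iff = finite_place_val_ring_iff(2)[OF F v]
  have RF: "val_ring F v \<subseteq> F" by (auto simp: val_ring_def)
  assume "reduces_to F v n (divisor_pts n a B) X"
  then obtain y c where c: "c \<in> F" "c \<noteq> 0" "\<forall>i\<le>n. y i = c * X i"
    and y: "\<And>i. i \<le> n \<Longrightarrow> y i \<in> val_ring F v" "\<exists>i\<le>n. y i \<notin> val_max_ideal F v"
    and van: "\<And>f. f \<in> vanishing_ideal F n (divisor_pts n a B) \<Longrightarrow>
      homogeneous_poly n (val_ring F v) f \<Longrightarrow> mpeval f y \<in> val_max_ideal F v"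
    unfolding reduces_to_def by blast
  have liny: "lin_form n (a i) y = c * lin_form n (a i) X" for i
    unfolding lin_form_scale[symmetric] by (rule lin_form_cong) (use c in auto)
  have quady: "quad_form n B y = c\<^sup>2 * quad_form n B X"
    unfolding quad_form_scale[symmetric] by (rule quad_form_cong) (use c in auto)
  \<comment> \<open>As \<open>n\<close> is at least 2, there is a hyperplane; its equation bounds
    the value of \<open>c\<close> from above.\<close>
  have one: "1 \<in> {1..n-1}" using n by auto
  have "lin_form n (a 1) y \<in> val_ring F v"
    unfolding lin_form_def by (rule sum_closed) (use R a one y in auto)
  then have "\<phi> c \<le> 1"
    using R_iff[of "lin_form n (a 1) y"] RF lin[OF one] c by (auto simp: liny val_mult)
  moreover obtain i where i: "i \<le> n" "y i \<notin> val_max_ideal F v" using y by blast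
  have "X i \<in> F" "\<phi> (X i) \<le> 1" using X[OF i(1)] R_iff RF by auto
  then have "\<phi> c \<ge> 1"
    using i c m_iff[of "y i"] closed mult_left_le[of "\<phi> (X i)" "\<phi> c"] by (auto simp: val_mult)
  ultimately have c1: "\<phi> c = 1" by simp
  obtain f d where f: "homogeneous_of_degree n (val_ring F v) d f"
    "\<And>x. mpeval f x = (\<Prod>i\<in>{1..n-1}. lin_form n (a i) x) * quad_form n B x"
    using exists_divisor_mpoly[of "val_ring F v" "{1..n-1}" n a B] R a B by blast
  have hom: "homogeneous_poly n (val_ring F v) f"
    using f(1) by (rule homogeneous_of_degree_imp_homogeneous_poly)
  then have "homogeneous_poly n F f" using RF by (auto simp: homogeneous_poly_def)
  then have "f \<in> vanishing_ideal F n (divisor_pts n a B)"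
    by (auto simp: vanishing_ideal_def divisor_pts_def f(2))
  then have m: "mpeval f y \<in> val_max_ideal F v" using van hom by blast
  have P: "\<phi> (\<Prod>i\<in>{1..n-1}. lin_form n (a i) y) = (\<Prod>i\<in>{1..n-1}. \<phi> (lin_form n (a i) y)) \<and>
      (\<Prod>i\<in>{1..n-1}. lin_form n (a i) y) \<in> F"
    by (rule val_prod) (use lin c closed in \<open>auto simp: liny\<close>)
  have "(\<Prod>i\<in>{1..n-1}. \<phi> (lin_form n (a i) y)) = 1"
    by (rule prod.neutral) (use lin c c1 in \<open>auto simp: liny val_mult\<close>)
  then have "\<phi> (mpeval f y) = 1"
    using P quad c c1 closed unfolding f(2) by (simp add: val_mult quady val_power)
  moreover have "mpeval f y \<in> F" using m by (auto simp: val_max_ideal_def)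
  ultimately show False using m m_iff by auto
qed

section \<open>The family of integral points and its density\<close>

lemma infinite_powers_of_2: "infinite (range (\<lambda>k::nat. (2::complex) ^ k))"
proof -
  have "inj (\<lambda>k::nat. (2::complex) ^ k)"
  proof (rule injI)
    fix k l :: nat assume "(2::complex) ^ k = 2 ^ l"
    then have "norm ((2::complex) ^ k) = norm ((2::complex) ^ l)" by simp
    then show "k = l" by (simp add: norm_power)
  qed
  then show ?thesis by (rule range_inj_infinite)
qed

text \<open>Coordinate vectors are functions on all natural numbers, while the adapted coordinates
  describe them only up to index \<open>n\<close>.\<close>

lemma mpeval_cong:
  assumes "homogeneous_poly n R f" "\<And>j. j \<le> n \<Longrightarrow> x j = y j"
  shows "mpeval f x = mpeval f y"
proof -
  have "x i = y i" if "m \<in> Poly_Mapping.keys f" "i \<in> Poly_Mapping.keys m" for m i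
    using assms that unfolding homogeneous_poly_def by blast
  then show ?thesis unfolding mpeval_def by (intro sum.cong refl arg_cong2[of _ _ _ _ "(*)"] prod.cong) auto
qed

theorem theorem1p1:
  fixes K :: "complex set" and S :: "(complex \<Rightarrow> real) set set" and n :: nat
    and a :: "nat \<Rightarrow> nat \<Rightarrow> complex" and B :: "nat \<Rightarrow> nat \<Rightarrow> complex"
  assumes "number_field K"
    and "admissible_places K S"
    and "n \<ge> 2"
    and "\<forall>i\<in>{1..n-1}. \<forall>j\<le>n. a i j \<in> K"
    and "general_position n (n - 1) a"
    and "\<forall>i\<le>n. \<forall>j\<le>n. B i j \<in> K"
    and "smooth_quadric n B"
    and "\<exists>p1 p2. proj_point K n p1 \<and> proj_point K n p2 \<and> \<not> proj_eq n p1 p2 \<and>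
           p1 \<in> line_quadric_pts n a B \<and> p2 \<in> line_quadric_pts n a B \<and>
           (\<forall>x\<in>line_quadric_pts n a B. proj_eq n p1 x \<or> proj_eq n p2 x)"
  shows "potentially_dense_integral K S n (divisor_pts n a B)"
proof -
  have K: "subfield K" using assms(1) by (simp add: number_field_def)
  obtain p1 p2 where p: "proj_point K n p1" "proj_point K n p2" "\<not> proj_eq n p1 p2"
    "p1 \<in> line_quadric_pts n a B" "p2 \<in> line_quadric_pts n a B"
    "\<forall>x\<in>line_quadric_pts n a B. proj_eq n p1 x \<or> proj_eq n p2 x"
    using assms(8) by blast
  let ?I = "{1..n-1}"
  obtain e c where c: "c \<in> K" "c \<noteq> 0"
    and eK: "\<forall>i\<in>?I. \<forall>j\<le>n. e i j \<in> K"
    and e: "\<forall>i\<in>?I. \<forall>k\<in>?I. lin_form n (a i) (e k) = (if i = k then 1 else 0)"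
    and quad: "\<forall>x u w. quad_form n B (\<lambda>j. (\<Sum>i\<in>?I. x i * e i j) + u * p1 j + w * p2 j) =
           quad_form n B (\<lambda>j. \<Sum>i\<in>?I. x i * e i j) + c * u * w"
    and complete: "\<forall>Y. \<exists>x u w. \<forall>j\<le>n. Y j = (\<Sum>i\<in>?I. x i * e i j) + u * p1 j + w * p2 j"
    using adapted_coordinates[OF K assms(4,5,6) p(1,4,2,5,3,6)] by (elim exE conjE)
  have pK: "\<And>j. j \<le> n \<Longrightarrow> p1 j \<in> K" "\<And>j. j \<le> n \<Longrightarrow> p2 j \<in> K"
    using p(1,2) by (auto simp: proj_point_def)
  have L: "\<And>i. i \<in> ?I \<Longrightarrow> lin_form n (a i) p1 = 0" "\<And>i. i \<in> ?I \<Longrightarrow> lin_form n (a i) p2 = 0"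
    using p(4,5) by (auto simp: line_quadric_pts_def)
  define q where "q z = quad_form n B (\<lambda>j. \<Sum>i\<in>?I. z i * e i j)" for z
  \<comment> \<open>The point \<open>(x : u : (e - q(x)) / (c u))\<close> scaled by \<open>u = z 0\<close>, with \<open>e = z n\<close>,
    so that it is polynomial in the parameters.\<close>
  define X where "X z = (\<lambda>j. (\<Sum>i\<in>?I. (z 0 * z i) * e i j) + (z 0)\<^sup>2 * p1 j + (z n - q z) / c * p2 j)"
    for z :: "nat \<Rightarrow> complex"
  have linX: "lin_form n (a k) (X z) = z 0 * z k" if k: "k \<in> ?I" for k z
  proof -
    have "(\<Sum>i\<in>?I. z 0 * z i * lin_form n (a k) (e i)) = (\<Sum>i\<in>?I. if k = i then z 0 * z i else 0)"
      by (rule sum.cong) (use e k in auto)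
    then have "(\<Sum>i\<in>?I. z 0 * z i * lin_form n (a k) (e i)) = z 0 * z k" using k by simp
    then show ?thesis unfolding X_def lin_form_add lin_form_sum lin_form_scale using L k by simp
  qed
  have quadX: "quad_form n B (X z) = (z 0)\<^sup>2 * z n" for z
  proof -
    have "(\<lambda>j. \<Sum>i\<in>?I. (z 0 * z i) * e i j) = (\<lambda>j. z 0 * (\<Sum>i\<in>?I. z i * e i j))"
      by (simp add: sum_distrib_left mult.assoc)
    then have "quad_form n B (\<lambda>j. \<Sum>i\<in>?I. (z 0 * z i) * e i j) = (z 0)\<^sup>2 * q z"
      by (simp add: quad_form_scale q_def)
    then show ?thesis unfolding X_def quad[rule_format] using c by (simp add: field_simps)
  qed
  \<comment> \<open>Everything that must be integral outside the enlarged set of places: the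
    coefficients of the equations and of the new coordinates, \<open>inverse c\<close> for the
    division by \<open>c\<close>, and \<open>1 / 2\<close> to make 2 a unit.\<close>
  define T where "T = (\<lambda>(i, j). a i j) ` (?I \<times> {..n}) \<union> (\<lambda>(i, j). B i j) ` ({..n} \<times> {..n}) \<union>
     (\<lambda>(i, j). e i j) ` (?I \<times> {..n}) \<union> p1 ` {..n} \<union> p2 ` {..n} \<union> {inverse c, 1 / 2}"
  have "finite T" by (simp add: T_def)
  have "2 \<in> K" using subfield_of_nat[OF K, of 2] by simp
  have "T \<subseteq> K"
    using assms(4,6) eK pK c \<open>2 \<in> K\<close> subfield_divide[OF K subfield_one[OF K], of 2]
    by (auto simp: T_def intro: subfield_inverse[OF K])
  define S' where "S' = S \<union> (\<Union>t\<in>T. {v. finite_place K v \<and> t \<notin> val_ring K v})"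
  define A where "A = range (\<lambda>k::nat. (2::complex) ^ k)"
  have AK: "A \<subseteq> K" using \<open>2 \<in> K\<close> by (auto simp: A_def intro: subfield_power[OF K])
  have adm: "admissible_places K S'"
    using assms(2) \<open>finite T\<close> \<open>T \<subseteq> K\<close> finite_nonintegral_places[OF assms(1)]
    by (auto simp: admissible_places_def S'_def finite_place_def)
  \<comment> \<open>With \<open>K\<close> itself as the extension, a place over \<open>v\<close> is
    \<open>v\<close>: absolute values are 0 outside \<open>K\<close> by convention, so agreement on
    \<open>K\<close> is equality.\<close>
  have over: "w \<in> S'" if wv: "place K w" "v \<in> S" "lies_over K w v" for w v
  proof -
    have v: "place K v" using assms(2) that by (auto simp: admissible_places_def)
    obtain \<psi> \<phi> where h: "\<psi> \<in> w" "\<phi> \<in> v" "\<forall>x\<in>K. \<psi> x = \<phi> x" using wv by (auto simp: lies_over_def)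
    have "abs_val K \<psi>" "abs_val K \<phi>" using h v that by (auto simp: place_def)
    then have "\<psi> x = \<phi> x" for x using h(3) by (cases "x \<in> K") (auto simp: abs_val_def)
    then have "\<psi> = \<phi>" by auto
    then have "w = v" using place_eq_class[OF K that(1) h(1)] place_eq_class[OF K v h(2)] by simp
    then show ?thesis using that by (simp add: S'_def)
  qed
  have integral: "X z \<in> integral_points K S' n (divisor_pts n a B)" if z: "\<And>i. i < Suc n \<Longrightarrow> z i \<in> A" for z
  proof -
    have zK: "z i \<in> K" "z i \<noteq> 0" if "i \<le> n" for i using z[of i] AK that by (auto simp: A_def)
    have qK: "q z \<in> K"
      unfolding q_def quad_form_def using assms(6) eK zK
      by (auto intro!: subfield_sum[OF K] subfield_mult[OF K])
    have XK: "X z j \<in> K" if "j \<le> n" for j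
      unfolding X_def using eK pK zK qK c that
      by (auto intro!: subfield_sum[OF K] subfield_mult[OF K] subfield_add[OF K] subfield_power[OF K]
          subfield_divide[OF K] subfield_diff[OF K])
    have one: "1 \<in> ?I" using assms(3) by auto
    have "lin_form n (a 1) (X z) \<noteq> 0" using linX[OF one] zK one by auto
    then have "\<exists>j\<le>n. X z j \<noteq> 0" by (auto simp: lin_form_def elim!: sum.not_neutral_contains_not_neutral)
    then have "proj_point K n (X z)" using XK by (auto simp: proj_point_def)
    moreover have "\<not> reduces_to K v n (divisor_pts n a B) (X z)" if v: "finite_place K v" "v \<notin> S'" for v
    proof -
      let ?R = "val_ring K v"
      obtain \<phi> where \<phi>: "\<phi> \<in> v" using place_nonempty[of K v] v by (auto simp: finite_place_def)
      interpret nonarch_field K \<phi> by (rule finite_place_nonarch_field[OF K v(1) \<phi>])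
      note R = val_ring_closed[OF K v(1)]
      have T: "T \<subseteq> ?R" using v by (auto simp: S'_def)
      have aR: "\<And>i j. i \<in> ?I \<Longrightarrow> j \<le> n \<Longrightarrow> a i j \<in> ?R" and BR: "\<And>i j. i \<le> n \<Longrightarrow> j \<le> n \<Longrightarrow> B i j \<in> ?R"
        and eR: "\<And>i j. i \<in> ?I \<Longrightarrow> j \<le> n \<Longrightarrow> e i j \<in> ?R" and pR: "\<And>j. j \<le> n \<Longrightarrow> p1 j \<in> ?R" "\<And>j. j \<le> n \<Longrightarrow> p2 j \<in> ?R"
        and cR: "inverse c \<in> ?R" and hR: "1 / 2 \<in> ?R"
        by (rule subsetD[OF T]; force simp: T_def)+
      have "\<phi> (1 / 2) \<le> 1"
        using finite_place_val_ring_iff(1)[OF K v(1) \<phi>, of "1 / 2"] hR \<open>T \<subseteq> K\<close> by (simp add: T_def)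
      then have "\<phi> 2 \<ge> 1"
        using \<open>2 \<in> K\<close> val_pos[of 2] closed(2) val_divide[of 1 2] by (simp add: field_simps)
      moreover have "\<phi> 2 \<le> 1" using val_of_nat[of 2] by simp
      ultimately have "\<phi> 2 = 1" by simp
      then have z1: "\<phi> (z i) = 1" if "i \<le> n" for i
        using z[of i] that \<open>2 \<in> K\<close> by (auto simp: A_def val_power)
      then have zR: "z i \<in> ?R" if "i \<le> n" for i
        using finite_place_val_ring_iff(1)[OF K v(1) \<phi>] zK that by auto
      have sumR: "sum f I \<in> ?R" if "\<And>i. i \<in> I \<Longrightarrow> f i \<in> ?R" for f and I :: "nat set"
        by (rule sum_closed) (use R that in auto)
      have qR: "q z \<in> ?R"
        unfolding q_def quad_form_def using BR eR zR by (auto intro!: sumR R)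
      have XR: "X z j \<in> ?R" if "j \<le> n" for j
        unfolding X_def divide_inverse using eR pR zR qR cR that by (auto intro!: sumR R)
      show ?thesis
      proof (rule not_reduces_to_divisor[OF K v(1) \<phi> assms(3) aR BR XR])
        fix i assume i: "i \<in> ?I"
        then show "lin_form n (a i) (X z) \<in> K \<and> \<phi> (lin_form n (a i) (X z)) = 1"
          using z1[of 0] z1[of i] zK by (auto simp: linX val_mult closed)
      next
        show "quad_form n B (X z) \<in> K \<and> \<phi> (quad_form n B (X z)) = 1"
          using z1[of 0] z1[of n] zK by (auto simp: quadX val_mult val_power closed)
      qed
    qed
    ultimately show ?thesis by (simp add: integral_points_def)
  qed
  have "zariski_dense K n (integral_points K S' n (divisor_pts n a B))"
    unfolding zariski_dense_def
  proof (intro allI impI, elim conjE)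
    fix f assume f: "homogeneous_poly n K f" and van: "\<forall>x\<in>integral_points K S' n (divisor_pts n a B). mpeval f x = 0"
    \<comment> \<open>Integrality is known only for parameters that are powers of 2. These are
      infinitely many, so the vanishing extends to arbitrary complex parameters.\<close>
    have zero: "mpeval f (X z) = 0" for z
    proof (rule separately_polyfun_eq_0[of "\<lambda>z. mpeval f (X z)" A "Suc n"])
      show "polyfun (\<lambda>t. mpeval f (X (z(i := t))))" for z i
        unfolding X_def q_def quad_form_def by (rule polyfun_mpeval) (intro polyfun_add polyfun_diff
          polyfun_mult polyfun_sum polyfun_power polyfun_divide_const polyfun_const polyfun_fun_upd)
      show "infinite A" unfolding A_def by (rule infinite_powers_of_2)
    qed (use van integral in blast)
    have generic: "mpeval f (\<lambda>j. (\<Sum>i\<in>?I. x i * e i j) + u * p1 j + w * p2 j) = 0" if "u \<noteq> 0" for x u w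
    proof -
      \<comment> \<open>The coefficient of \<open>p1\<close> in \<open>X z\<close> is the square of
        \<open>z 0\<close>, so a complex square root of \<open>u\<close> is needed; dividing
        \<open>x i\<close> by it undoes the scaling in the other coordinates.\<close>
      define s where "s = csqrt u"
      have s: "s\<^sup>2 = u" "s \<noteq> 0" using \<open>u \<noteq> 0\<close> by (auto simp: s_def)
      define z0 where "z0 = (\<lambda>i. if i = 0 then s else x i / s)"
      \<comment> \<open>Solves \<open>(z n - q z) / c = w\<close> for the last parameter. Since
        \<open>q\<close> uses only the indices 1 to \<open>n - 1\<close>, overwriting index
        \<open>n\<close> does not change it.\<close>
      define z where "z = z0(n := c * w + q z0)"
      have n0: "n \<noteq> 0" "n \<notin> ?I" using assms(3) by auto
      have zI: "z 0 = s" "\<And>i. i \<in> ?I \<Longrightarrow> z i = x i / s" using n0 by (auto simp: z_def z0_def)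
      have "(\<Sum>i\<in>?I. z i * e i j) = (\<Sum>i\<in>?I. z0 i * e i j)" for j
        by (rule sum.cong) (use n0 in \<open>auto simp: z_def\<close>)
      then have "q z = q z0" by (simp add: q_def)
      then have "(z n - q z) / c = w" using c by (simp add: z_def)
      moreover have "(\<Sum>i\<in>?I. (z 0 * z i) * e i j) = (\<Sum>i\<in>?I. x i * e i j)" for j
        by (rule sum.cong) (use zI s in auto)
      ultimately have "X z = (\<lambda>j. (\<Sum>i\<in>?I. x i * e i j) + u * p1 j + w * p2 j)"
        unfolding X_def using zI s by simp
      then show ?thesis using zero[of z] by simp
    qed
    have "mpeval f Y = 0" for Y
    proof -
      obtain x u w where Y: "\<forall>j\<le>n. Y j = (\<Sum>i\<in>?I. x i * e i j) + u * p1 j + w * p2 j"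
        using complete by blast
      \<comment> \<open>The remaining case of coefficient 0 at \<open>p1\<close> follows because a
        polynomial in this coefficient vanishing off 0 vanishes at 0 too.\<close>
      have "polyfun (\<lambda>t. mpeval f (\<lambda>j. (\<Sum>i\<in>?I. x i * e i j) + t * p1 j + w * p2 j))"
        by (rule polyfun_mpeval) (intro polyfun_add polyfun_mult polyfun_const polyfun_ident)
      moreover have "infinite (- {0::complex})" by (simp add: infinite_UNIV_char_0 finite_compl)
      ultimately have "mpeval f (\<lambda>j. (\<Sum>i\<in>?I. x i * e i j) + u * p1 j + w * p2 j) = 0"
        by (rule polyfun_eq_0_if_infinite_zeros) (use generic in auto)
      moreover have "mpeval f Y = mpeval f (\<lambda>j. (\<Sum>i\<in>?I. x i * e i j) + u * p1 j + w * p2 j)"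
        by (rule mpeval_cong[OF f]) (rule Y[rule_format])
      ultimately show ?thesis by simp
    qed
    then show "f = 0"
      using mpoly_eq_0_if_vanishing[of f n] f by (auto simp: homogeneous_poly_def)
  qed
  then show ?thesis
    unfolding potentially_dense_integral_def
    using assms(1) adm over by blast
qed

end
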